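(* Let $(X;\mu)$ be a $\sigma$-finite measure space, $\{U_t\}_{t\geq0}$ a continuous stochastic semigroup with respect to $(X;\mu)$, $H$ its infinitesimal generator, and $O\in L^\infty_{\mathbb{R}}(X;\mu)$ an observable. Let $\{U_t^\sharp\}_{t\ge0}$ be the dual semigroup on $L^\infty_{\mathbb{R}}(X;\mu)$ and $H^\sharp$ its $w^*$-infinitesimal generator. The following assertions are equivalent: (i) $[O,U_t]=0$ for all real $t\geq0$. (ii) For every probability distribution $g$ on $(X;\mu)$, the expected values $\langle O,U_tg\rangle$ and $\langle O^2,U_tg\rangle$ are constant with respect to $t\geq0$. (iii) $[O,H]=0$, in the sense that the operator of multiplication with $O$ leaves $\operatorname{Dom}(H)$ invariant and $OHg=HOg$ for all $g\in\operatorname{Dom}(H)$. (i)$'$ $[O,U_t^\sharp]=0$ for all real $t\geq0$. (ii)$'$ $U_t^\sharp(O)=O$ and $U_t^\sharp(O^2)=O^2$ for all real $t\geq0$. (iii)$'$ Both $O$ and $O^2$ are in the kernel of $H^\sharp$, that is, $O,O^2\in\operatorname{Dom}(H^\sharp)$ and $H^\sharp(O)=H^\sharp(O^2)=0$.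
   Context: $L^1_{\mathbb{R}}(X;\mu)$ and $L^\infty_{\mathbb{R}}(X;\mu)$ are the real Lebesgue spaces, with pairing $\langle f,g\rangle=\int_Xf(x)g(x)\,d\mu(x)$ for $f\in L^\infty_{\mathbb{R}}$, $g\in L^1_{\mathbb{R}}$. A probability distribution is an element $g\geq0$ of $L^1_{\mathbb{R}}(X;\mu)$ with $\|g\|_1=1$. An observable $O\in L^\infty_{\mathbb{R}}(X;\mu)$ is identified with the operator of multiplication by $O$ (on $L^1_{\mathbb{R}}$ or on $L^\infty_{\mathbb{R}}$, according to context). A stochastic operator is a bounded linear operator on $L^1_{\mathbb{R}}(X;\mu)$ mapping probability distributions to probability distributions. A continuous stochastic semigroup is a strongly continuous one-parameter semigroup of stochastic operators on $L^1_{\mathbb{R}}(X;\mu)$ ($U_sU_t=U_{s+t}$, $U_0=I$, $t\mapsto U_tg$ norm continuous on $[0,\infty)$ for each $g$). Its infinitesimal generator is $Hg=\lim_{t\to0+}(U_tg-g)/t$, with domain $\operatorname{Dom}(H)$ all $g$ for which the limit exists in $L^1_{\mathbb{R}}$. $U_t^\sharp$ is the dual operator on $L^\infty_{\mathbb{R}}(X;\mu)$, $\langle f,U_tg\rangle=\langle U_t^\sharp f,g\rangle$, and $H^\sharp f=w^*\text{-}\lim_{t\to0+}(U_t^\sharp f-f)/t$, with domain $\operatorname{Dom}(H^\sharp)$ all $f\in L^\infty_{\mathbb{R}}(X;\mu)$ for which this $w^*$-limit exists. $[S,T]=ST-TS$. *)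

theory Defs
  imports "HOL-Analysis.Analysis"
begin

text \<open>
  Elements of the Lebesgue spaces are represented by real functions, and equality in \<open>L\<^sup>1\<close> and
  \<open>L\<^sup>\<infinity>\<close> is equality almost everywhere. An operator on such a space is a map on representatives
  that respects almost-everywhere equality; its values outside the space are irrelevant.
\<close>

definition L1 :: "'a measure \<Rightarrow> ('a \<Rightarrow> real) set" where
  "L1 M = {g. integrable M g}"

definition Linf :: "'a measure \<Rightarrow> ('a \<Rightarrow> real) set" where
  "Linf M = {f \<in> borel_measurable M. \<exists>C. AE x in M. \<bar>f x\<bar> \<le> C}"

definition norm_L1 :: "'a measure \<Rightarrow> ('a \<Rightarrow> real) \<Rightarrow> real" where
  "norm_L1 M g = (\<integral>x. \<bar>g x\<bar> \<partial>M)"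

definition ae_eq :: "'a measure \<Rightarrow> ('a \<Rightarrow> real) \<Rightarrow> ('a \<Rightarrow> real) \<Rightarrow> bool" where
  "ae_eq M f g \<longleftrightarrow> (AE x in M. f x = g x)"

definition pairing :: "'a measure \<Rightarrow> ('a \<Rightarrow> real) \<Rightarrow> ('a \<Rightarrow> real) \<Rightarrow> real" where
  "pairing M f g = (\<integral>x. f x * g x \<partial>M)"

definition prob_distribution :: "'a measure \<Rightarrow> ('a \<Rightarrow> real) \<Rightarrow> bool" where
  "prob_distribution M g \<longleftrightarrow> g \<in> L1 M \<and> (AE x in M. 0 \<le> g x) \<and> norm_L1 M g = 1"

definition bounded_linear_L1 ::
    "'a measure \<Rightarrow> (('a \<Rightarrow> real) \<Rightarrow> ('a \<Rightarrow> real)) \<Rightarrow> bool" where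
  "bounded_linear_L1 M T \<longleftrightarrow>
     (\<forall>g\<in>L1 M. T g \<in> L1 M) \<and>
     (\<forall>g\<in>L1 M. \<forall>h\<in>L1 M. ae_eq M g h \<longrightarrow> ae_eq M (T g) (T h)) \<and>
     (\<forall>g\<in>L1 M. \<forall>h\<in>L1 M. \<forall>a b. 
        ae_eq M (T (\<lambda>x. a * g x + b * h x)) (\<lambda>x. a * T g x + b * T h x)) \<and>
     (\<exists>C. \<forall>g\<in>L1 M. norm_L1 M (T g) \<le> C * norm_L1 M g)"

definition stochastic_operator ::
    "'a measure \<Rightarrow> (('a \<Rightarrow> real) \<Rightarrow> ('a \<Rightarrow> real)) \<Rightarrow> bool" where
  "stochastic_operator M T \<longleftrightarrow>
     bounded_linear_L1 M T \<and> (\<forall>g. prob_distribution M g \<longrightarrow> prob_distribution M (T g))"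

text \<open>Only the operators \<open>U t\<close> with \<open>t \<ge> 0\<close> are meaningful.\<close>

definition continuous_stochastic_semigroup ::
    "'a measure \<Rightarrow> (real \<Rightarrow> ('a \<Rightarrow> real) \<Rightarrow> ('a \<Rightarrow> real)) \<Rightarrow> bool" where
  "continuous_stochastic_semigroup M U \<longleftrightarrow>
     (\<forall>t\<ge>0. stochastic_operator M (U t)) \<and>
     (\<forall>s\<ge>0. \<forall>t\<ge>0. \<forall>g\<in>L1 M. ae_eq M (U s (U t g)) (U (s + t) g)) \<and>
     (\<forall>g\<in>L1 M. ae_eq M (U 0 g) g) \<and>
     (\<forall>g\<in>L1 M. \<forall>s\<ge>0.
        ((\<lambda>t. norm_L1 M (\<lambda>x. U t g x - U s g x)) \<longlongrightarrow> 0) (at s within {0..}))"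

definition is_generator_value ::
    "'a measure \<Rightarrow> (real \<Rightarrow> ('a \<Rightarrow> real) \<Rightarrow> ('a \<Rightarrow> real)) \<Rightarrow> ('a \<Rightarrow> real) \<Rightarrow> ('a \<Rightarrow> real) \<Rightarrow> bool" where
  "is_generator_value M U g h \<longleftrightarrow> h \<in> L1 M \<and>
     ((\<lambda>t. norm_L1 M (\<lambda>x. (U t g x - g x) / t - h x)) \<longlongrightarrow> 0) (at_right 0)"

definition generator_dom ::
    "'a measure \<Rightarrow> (real \<Rightarrow> ('a \<Rightarrow> real) \<Rightarrow> ('a \<Rightarrow> real)) \<Rightarrow> ('a \<Rightarrow> real) set" where
  "generator_dom M U = {g \<in> L1 M. \<exists>h. is_generator_value M U g h}"

definition generator ::
    "'a measure \<Rightarrow> (real \<Rightarrow> ('a \<Rightarrow> real) \<Rightarrow> ('a \<Rightarrow> real)) \<Rightarrow> ('a \<Rightarrow> real) \<Rightarrow> ('a \<Rightarrow> real)" where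
  "generator M U g = (SOME h. is_generator_value M U g h)"

text \<open>
  On a \<open>\<sigma>\<close>-finite measure space, \<open>L\<^sup>\<infinity>\<close> is the dual of \<open>L\<^sup>1\<close>; hence for every bounded linear
  operator \<open>T\<close> on \<open>L\<^sup>1\<close> and every \<open>f\<close> in \<open>L\<^sup>\<infinity>\<close> the element chosen here exists and is unique up
  to almost-everywhere equality.
\<close>

definition dual_op ::
    "'a measure \<Rightarrow> (('a \<Rightarrow> real) \<Rightarrow> ('a \<Rightarrow> real)) \<Rightarrow> ('a \<Rightarrow> real) \<Rightarrow> ('a \<Rightarrow> real)" where
  "dual_op M T f =
     (SOME h. h \<in> Linf M \<and> (\<forall>g\<in>L1 M. pairing M f (T g) = pairing M h g))"

definition is_wstar_generator_value ::
    "'a measure \<Rightarrow> (real \<Rightarrow> ('a \<Rightarrow> real) \<Rightarrow> ('a \<Rightarrow> real)) \<Rightarrow> ('a \<Rightarrow> real) \<Rightarrow> ('a \<Rightarrow> real) \<Rightarrow> bool" where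
  "is_wstar_generator_value M V f h \<longleftrightarrow> h \<in> Linf M \<and>
     (\<forall>g\<in>L1 M. ((\<lambda>t. pairing M (\<lambda>x. (V t f x - f x) / t) g) \<longlongrightarrow> pairing M h g) (at_right 0))"

definition wstar_generator_dom ::
    "'a measure \<Rightarrow> (real \<Rightarrow> ('a \<Rightarrow> real) \<Rightarrow> ('a \<Rightarrow> real)) \<Rightarrow> ('a \<Rightarrow> real) set" where
  "wstar_generator_dom M V = {f \<in> Linf M. \<exists>h. is_wstar_generator_value M V f h}"

definition wstar_generator ::
    "'a measure \<Rightarrow> (real \<Rightarrow> ('a \<Rightarrow> real) \<Rightarrow> ('a \<Rightarrow> real)) \<Rightarrow> ('a \<Rightarrow> real) \<Rightarrow> ('a \<Rightarrow> real)" where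
  "wstar_generator M V f = (SOME h. is_wstar_generator_value M V f h)"

definition mult_op :: "('a \<Rightarrow> real) \<Rightarrow> ('a \<Rightarrow> real) \<Rightarrow> ('a \<Rightarrow> real)" where
  "mult_op A g = (\<lambda>x. A x * g x)"

definition commutator ::
    "(('a \<Rightarrow> real) \<Rightarrow> ('a \<Rightarrow> real)) \<Rightarrow> (('a \<Rightarrow> real) \<Rightarrow> ('a \<Rightarrow> real)) \<Rightarrow> ('a \<Rightarrow> real) \<Rightarrow> ('a \<Rightarrow> real)" where
  "commutator S T g = (\<lambda>x. S (T g) x - T (S g) x)"

end

theory Submission
  imports Defs
begin

text \<open>
  Let \<open>V\<^sub>t\<close> be the dual of \<open>U\<^sub>t\<close>; it is positive and, because \<open>U\<^sub>t\<close> preserves integrals, fixes the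
  constants. Call \<open>f\<close> conserved if \<open>\<langle>f, U\<^sub>t g\<rangle> = \<langle>f, g\<rangle>\<close> for all \<open>t\<close> and \<open>g\<close>. Constancy of the expected
  values, being a fixed point of all \<open>V\<^sub>t\<close>, and lying in the kernel of the weak-star generator are all
  reformulations of conservation of the observable and of its square (lemmas
  \<open>conserved_iff_expectation_constant\<close>, \<open>conserved_iff_dual_op_fixed\<close> and
  \<open>conserved_iff_wstar_generator_zero\<close>). In the last case a continuous function whose right derivative
  is zero everywhere has to be constant.

  The heart of the matter is that conservation of \<open>A\<close> and \<open>A\<^sup>2\<close> already implies commutation
  (\<open>dual_op_multiplicative\<close>). In terms of probability, the variance of \<open>A\<close> is constant, so mass
  starting near a level set of \<open>A\<close> stays near it. The proof expands \<open>V\<^sub>t ((A - l + s f)\<^sup>2) \<ge> 0\<close> and reads off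
  \<open>V\<^sub>t (A f) = A V\<^sub>t f\<close>; pairing transfers this to \<open>U\<^sub>t\<close> (\<open>commute_iff_dual_commute\<close>). Conversely, if \<open>A\<close>
  commutes with \<open>U\<^sub>t\<close> then \<open>\<langle>A, U\<^sub>t g\<rangle>\<close> is the integral of \<open>U\<^sub>t (A g)\<close>, hence of \<open>A g\<close>, and the square
  is treated by doing this twice.

  Commutation with the semigroup passes to the generator \<open>H\<close> by taking limits. If only \<open>H\<close>
  commutes with \<open>A\<close>, then for \<open>g\<close> in the domain \<open>\<langle>A, H g\<rangle>\<close> is the integral of \<open>H (A g)\<close>, which is zero
  since the semigroup preserves integrals, and therefore \<open>\<langle>A\<^sup>2, H g\<rangle> = \<langle>A, H (A g)\<rangle> = 0\<close>. So both
  observables are conserved along orbits in the domain. The domain contains the weak time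
  integrals of all orbits (\<open>orbit_integral_in_generator_dom\<close>), and letting the length of the time
  interval shrink extends conservation to all of \<open>L\<^sup>1\<close>.

  The dual operators and the time integrals are both constructed from
  \<open>normal_functional_representation\<close>, a consequence of the Radon--Nikodym theorem.
\<close>

section \<open>The pairing of bounded and integrable functions\<close>

lemma L1_measurable: "g \<in> L1 M \<Longrightarrow> g \<in> borel_measurable M"
  by (auto simp: L1_def)

lemma Linf_measurable: "f \<in> Linf M \<Longrightarrow> f \<in> borel_measurable M"
  by (auto simp: Linf_def)

lemma Linf_I: "f \<in> borel_measurable M \<Longrightarrow> AE x in M. \<bar>f x\<bar> \<le> C \<Longrightarrow> f \<in> Linf M"
  by (auto simp: Linf_def)

lemma Linf_bound:
  assumes "f \<in> Linf M"
  obtains C where "0 \<le> C" "AE x in M. \<bar>f x\<bar> \<le> C"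
proof -
  obtain C where C: "AE x in M. \<bar>f x\<bar> \<le> C" using assms by (auto simp: Linf_def)
  have "AE x in M. \<bar>f x\<bar> \<le> max 0 C" using C by eventually_elim auto
  then show ?thesis by (intro that[of "max 0 C"]) auto
qed

lemma L1_lin: "g \<in> L1 M \<Longrightarrow> h \<in> L1 M \<Longrightarrow> (\<lambda>x. a * g x + b * h x) \<in> L1 M"
  by (simp add: L1_def)

lemma L1_diff: "g \<in> L1 M \<Longrightarrow> h \<in> L1 M \<Longrightarrow> (\<lambda>x. g x - h x) \<in> L1 M"
  by (simp add: L1_def)

lemma L1_scale: "g \<in> L1 M \<Longrightarrow> (\<lambda>x. a * g x) \<in> L1 M"
  by (simp add: L1_def)

lemma L1_divide: "g \<in> L1 M \<Longrightarrow> (\<lambda>x. g x / a) \<in> L1 M"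
  by (simp add: L1_def)

lemma Linf_lin:
  assumes f: "f \<in> Linf M" and k: "k \<in> Linf M"
  shows "(\<lambda>x. a * f x + b * k x) \<in> Linf M"
proof -
  obtain C D where C: "AE x in M. \<bar>f x\<bar> \<le> C" and D: "AE x in M. \<bar>k x\<bar> \<le> D"
    using Linf_bound[OF f] Linf_bound[OF k] by metis
  have "AE x in M. \<bar>a * f x + b * k x\<bar> \<le> \<bar>a\<bar> * C + \<bar>b\<bar> * D"
    using C D
  proof eventually_elim
    case (elim x)
    have "\<bar>a * f x + b * k x\<bar> \<le> \<bar>a\<bar> * \<bar>f x\<bar> + \<bar>b\<bar> * \<bar>k x\<bar>"
      by (metis abs_mult abs_triangle_ineq)
    also have "\<dots> \<le> \<bar>a\<bar> * C + \<bar>b\<bar> * D"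
      using elim by (intro add_mono mult_left_mono) auto
    finally show ?case .
  qed
  then show ?thesis
    using f[THEN Linf_measurable] k[THEN Linf_measurable]
    by (intro Linf_I[where C = "\<bar>a\<bar> * C + \<bar>b\<bar> * D"]) auto
qed

lemma Linf_const: "(\<lambda>x. c) \<in> Linf M"
  by (rule Linf_I[where C = "\<bar>c\<bar>"]) auto

lemma Linf_mult:
  assumes f: "f \<in> Linf M" and k: "k \<in> Linf M"
  shows "(\<lambda>x. f x * k x) \<in> Linf M"
proof -
  obtain C D where C: "0 \<le> C" "AE x in M. \<bar>f x\<bar> \<le> C" and D: "AE x in M. \<bar>k x\<bar> \<le> D"
    using Linf_bound[OF f] Linf_bound[OF k] by metis
  have "AE x in M. \<bar>f x * k x\<bar> \<le> C * D"
    using C(2) D by eventually_elim (auto simp: abs_mult intro!: mult_mono C(1))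
  then show ?thesis
    using f[THEN Linf_measurable] k[THEN Linf_measurable] by (intro Linf_I[where C = "C * D"]) auto
qed

lemma Linf_indicator_Collect:
  assumes "Measurable.pred M P"
  shows "(\<lambda>x. if P x then 1 else 0 :: real) \<in> Linf M"
proof (rule Linf_I[where C = 1])
  note [measurable] = assms
  show "(\<lambda>x. if P x then 1 else 0 :: real) \<in> borel_measurable M" by measurable
qed auto

lemma Linf_times_L1:
  assumes f: "f \<in> Linf M" and g: "g \<in> L1 M"
  shows "(\<lambda>x. f x * g x) \<in> L1 M"
proof -
  obtain C where C: "0 \<le> C" "AE x in M. \<bar>f x\<bar> \<le> C" using Linf_bound[OF f] by blast
  have int: "integrable M (\<lambda>x. C * \<bar>g x\<bar>)" using g by (auto simp: L1_def)
  have "integrable M (\<lambda>x. f x * g x)"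
  proof (rule Bochner_Integration.integrable_bound[OF int])
    show "(\<lambda>x. f x * g x) \<in> borel_measurable M"
      using f[THEN Linf_measurable] g[THEN L1_measurable] by auto
    show "AE x in M. norm (f x * g x) \<le> norm (C * \<bar>g x\<bar>)"
      using C(2) by eventually_elim (auto simp: abs_mult C(1) intro!: mult_right_mono)
  qed
  then show ?thesis by (simp add: L1_def)
qed

lemma norm_L1_nonneg: "0 \<le> norm_L1 M g"
  by (simp add: norm_L1_def)

lemma norm_L1_cong:
  assumes "g \<in> L1 M" "h \<in> L1 M" "AE x in M. g x = h x"
  shows "norm_L1 M g = norm_L1 M h"
  unfolding norm_L1_def
proof (rule integral_cong_AE)
  show "AE x in M. \<bar>g x\<bar> = \<bar>h x\<bar>" using assms(3) by eventually_elim simp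
qed (use assms in \<open>auto dest: L1_measurable\<close>)

lemma norm_L1_mono:
  assumes "g \<in> L1 M" "h \<in> L1 M" "AE x in M. \<bar>g x\<bar> \<le> \<bar>h x\<bar>"
  shows "norm_L1 M g \<le> norm_L1 M h"
  unfolding norm_L1_def using assms by (intro integral_mono_AE) (auto simp: L1_def)

lemma norm_L1_scale: "norm_L1 M (\<lambda>x. a * g x) = \<bar>a\<bar> * norm_L1 M g"
  by (simp add: norm_L1_def abs_mult)

lemma norm_L1_triangle:
  assumes "g \<in> L1 M" "h \<in> L1 M"
  shows "norm_L1 M (\<lambda>x. g x - h x) \<le> norm_L1 M g + norm_L1 M h"
proof -
  have "(\<integral>x. \<bar>g x - h x\<bar> \<partial>M) \<le> (\<integral>x. \<bar>g x\<bar> + \<bar>h x\<bar> \<partial>M)"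
    using assms by (intro integral_mono) (auto simp: L1_def)
  also have "\<dots> = (\<integral>x. \<bar>g x\<bar> \<partial>M) + (\<integral>x. \<bar>h x\<bar> \<partial>M)"
    using assms by (intro Bochner_Integration.integral_add) (auto simp: L1_def)
  finally show ?thesis by (simp add: norm_L1_def)
qed

lemma norm_L1_eq_0:
  assumes "g \<in> L1 M" "norm_L1 M g = 0"
  shows "AE x in M. g x = 0"
  using assms integral_nonneg_eq_0_iff_AE[of M "\<lambda>x. \<bar>g x\<bar>"] by (auto simp: norm_L1_def L1_def)

lemma pairing_right_lin:
  assumes "f \<in> Linf M" "g \<in> L1 M" "h \<in> L1 M"
  shows "pairing M f (\<lambda>x. a * g x + b * h x) = a * pairing M f g + b * pairing M f h"
proof -
  have i: "integrable M (\<lambda>x. f x * g x)" "integrable M (\<lambda>x. f x * h x)"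
    using Linf_times_L1[OF assms(1,2)] Linf_times_L1[OF assms(1,3)] by (auto simp: L1_def)
  have "pairing M f (\<lambda>x. a * g x + b * h x) = (\<integral>x. a * (f x * g x) + b * (f x * h x) \<partial>M)"
    unfolding pairing_def by (intro Bochner_Integration.integral_cong) (auto simp: algebra_simps)
  then show ?thesis using i by (simp add: pairing_def)
qed

lemma pairing_right_diff:
  assumes "f \<in> Linf M" "g \<in> L1 M" "h \<in> L1 M"
  shows "pairing M f (\<lambda>x. g x - h x) = pairing M f g - pairing M f h"
  using pairing_right_lin[OF assms, of 1 "-1"] by simp

lemma pairing_diff_quotient:
  assumes "f \<in> Linf M" "g \<in> L1 M" "h \<in> L1 M"
  shows "pairing M f (\<lambda>x. (g x - h x) / r) = (pairing M f g - pairing M f h) / r"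
  using pairing_right_lin[OF assms, of "1/r" "-1/r"] by (simp add: diff_divide_distrib)

lemma pairing_left_lin:
  assumes "f \<in> Linf M" "k \<in> Linf M" "g \<in> L1 M"
  shows "pairing M (\<lambda>x. a * f x + b * k x) g = a * pairing M f g + b * pairing M k g"
proof -
  have i: "integrable M (\<lambda>x. f x * g x)" "integrable M (\<lambda>x. k x * g x)"
    using Linf_times_L1[OF assms(1,3)] Linf_times_L1[OF assms(2,3)] by (auto simp: L1_def)
  have "pairing M (\<lambda>x. a * f x + b * k x) g = (\<integral>x. a * (f x * g x) + b * (k x * g x) \<partial>M)"
    unfolding pairing_def by (intro Bochner_Integration.integral_cong) (auto simp: algebra_simps)
  then show ?thesis using i by (simp add: pairing_def)
qed

lemma pairing_mult: "pairing M (\<lambda>x. f x * k x) g = pairing M f (\<lambda>x. k x * g x)"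
  by (simp add: pairing_def mult.assoc)

lemma pairing_cong:
  assumes "f \<in> borel_measurable M" "f' \<in> borel_measurable M"
    and "g \<in> borel_measurable M" "g' \<in> borel_measurable M"
    and "AE x in M. f x = f' x" "AE x in M. g x = g' x"
  shows "pairing M f g = pairing M f' g'"
  unfolding pairing_def
proof (rule integral_cong_AE)
  show "AE x in M. f x * g x = f' x * g' x" using assms(5,6) by eventually_elim simp
qed (use assms in auto)

lemma pairing_right_cong:
  assumes "f \<in> Linf M" "g \<in> L1 M" "h \<in> L1 M" "AE x in M. g x = h x"
  shows "pairing M f g = pairing M f h"
  using assms by (intro pairing_cong) (auto dest: Linf_measurable L1_measurable)

lemma pairing_left_cong:
  assumes "f \<in> Linf M" "k \<in> Linf M" "g \<in> L1 M" "AE x in M. f x = k x"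
  shows "pairing M f g = pairing M k g"
  using assms by (intro pairing_cong) (auto dest: Linf_measurable L1_measurable)

lemma pairing_nonneg:
  assumes "AE x in M. 0 \<le> f x" "AE x in M. 0 \<le> g x"
  shows "0 \<le> pairing M f g"
  unfolding pairing_def
proof (rule integral_nonneg_AE)
  show "AE x in M. 0 \<le> f x * g x" using assms by eventually_elim simp
qed

lemma pairing_bound:
  assumes f: "f \<in> borel_measurable M" "AE x in M. \<bar>f x\<bar> \<le> C" and g: "g \<in> L1 M"
  shows "\<bar>pairing M f g\<bar> \<le> C * norm_L1 M g"
proof -
  have i: "integrable M (\<lambda>x. f x * g x)"
    using Linf_times_L1[OF Linf_I[OF f] g] by (simp add: L1_def)
  have "\<bar>pairing M f g\<bar> \<le> (\<integral>x. \<bar>f x * g x\<bar> \<partial>M)"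
    unfolding pairing_def by (rule integral_abs_bound)
  also have "\<dots> \<le> (\<integral>x. C * \<bar>g x\<bar> \<partial>M)"
  proof (rule integral_mono_AE)
    show "AE x in M. \<bar>f x * g x\<bar> \<le> C * \<bar>g x\<bar>"
      using f(2) by eventually_elim (auto simp: abs_mult intro!: mult_right_mono)
  qed (use i g in \<open>auto simp: L1_def\<close>)
  finally show ?thesis by (simp add: norm_L1_def)
qed

lemma norm_L1_dominated_convergence:
  assumes G: "\<And>n. G n \<in> L1 M" and g: "g \<in> L1 M" and w: "w \<in> L1 M"
    and bound: "\<And>n. AE x in M. \<bar>G n x\<bar> \<le> w x" and lim: "AE x in M. (\<lambda>n. G n x) \<longlonglongrightarrow> g x"
  shows "(\<lambda>n. norm_L1 M (\<lambda>x. G n x - g x)) \<longlonglongrightarrow> 0"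
proof -
  have "(\<lambda>n. \<integral>x. \<bar>G n x - g x\<bar> \<partial>M) \<longlonglongrightarrow> (\<integral>x. 0 \<partial>M)"
  proof (rule integral_dominated_convergence[where w = "\<lambda>x. w x + \<bar>g x\<bar>"])
    show "AE x in M. norm \<bar>G n x - g x\<bar> \<le> w x + \<bar>g x\<bar>" for n
      using bound[of n] by eventually_elim auto
    show "AE x in M. (\<lambda>n. \<bar>G n x - g x\<bar>) \<longlonglongrightarrow> 0"
      using lim by eventually_elim (simp add: LIM_zero tendsto_rabs_zero)
    show "(\<lambda>x. \<bar>G n x - g x\<bar>) \<in> borel_measurable M" for n
      using L1_measurable[OF G] L1_measurable[OF g] by auto
  qed (use g w in \<open>auto simp: L1_def\<close>)
  then show ?thesis by (simp add: norm_L1_def)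
qed

lemma pairing_tendsto:
  assumes f: "f \<in> Linf M" and G: "\<And>t. P t \<Longrightarrow> G t \<in> L1 M" and g: "g \<in> L1 M"
    and ev: "eventually P F"
    and lim: "((\<lambda>t. norm_L1 M (\<lambda>x. G t x - g x)) \<longlongrightarrow> 0) F"
  shows "((\<lambda>t. pairing M f (G t)) \<longlongrightarrow> pairing M f g) F"
proof -
  obtain C where C: "0 \<le> C" "AE x in M. \<bar>f x\<bar> \<le> C" using Linf_bound[OF f] by blast
  have "((\<lambda>t. pairing M f (G t) - pairing M f g) \<longlongrightarrow> 0) F"
  proof (rule Lim_null_comparison)
    show "((\<lambda>t. C * norm_L1 M (\<lambda>x. G t x - g x)) \<longlongrightarrow> 0) F"
      using tendsto_mult_right_zero[OF lim] .
    show "\<forall>\<^sub>F t in F. norm (pairing M f (G t) - pairing M f g) \<le> C * norm_L1 M (\<lambda>x. G t x - g x)"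
      using ev
    proof eventually_elim
      case (elim t)
      then show ?case
        using pairing_bound[OF Linf_measurable[OF f] C(2) L1_diff[OF G[OF elim] g]]
        by (simp add: pairing_right_diff[OF f G[OF elim] g])
    qed
  qed
  then show ?thesis by (simp add: LIM_zero_iff)
qed

text \<open>The norm of \<open>g\<close> is attained by pairing with its sign; this turns weak estimates that are
  uniform on the unit ball of \<open>L\<^sup>\<infinity>\<close> into norm estimates.\<close>

lemma norm_L1_eq_pairing_sgn:
  assumes "g \<in> L1 M"
  shows "(\<lambda>x. sgn (g x)) \<in> Linf M" "pairing M (\<lambda>x. sgn (g x)) g = norm_L1 M g"
proof -
  note [measurable] = L1_measurable[OF assms]
  have "(\<lambda>x. sgn (g x)) \<in> borel_measurable M" by measurable
  then show "(\<lambda>x. sgn (g x)) \<in> Linf M"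
    by (rule Linf_I[where C = 1]) (auto simp: sgn_real_def)
  show "pairing M (\<lambda>x. sgn (g x)) g = norm_L1 M g"
    by (auto simp: pairing_def norm_L1_def abs_sgn mult.commute)
qed

lemma L1_eqI:
  assumes g: "g \<in> L1 M" and h: "h \<in> L1 M"
    and eq: "\<And>f. f \<in> Linf M \<Longrightarrow> pairing M f g = pairing M f h"
  shows "AE x in M. g x = h x"
proof -
  let ?d = "\<lambda>x. g x - h x"
  have d: "?d \<in> L1 M" using g h by (rule L1_diff)
  have "norm_L1 M ?d = pairing M (\<lambda>x. sgn (?d x)) ?d"
    using norm_L1_eq_pairing_sgn(2)[OF d] by simp
  also have "\<dots> = 0"
    using pairing_right_diff[OF norm_L1_eq_pairing_sgn(1)[OF d] g h]
      eq[OF norm_L1_eq_pairing_sgn(1)[OF d]] by simp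
  finally show ?thesis using norm_L1_eq_0[OF d] by simp
qed

lemma L1_nonnegI:
  assumes g: "g \<in> L1 M"
    and pos: "\<And>k. k \<in> Linf M \<Longrightarrow> (\<And>x. 0 \<le> k x) \<Longrightarrow> 0 \<le> pairing M k g"
  shows "AE x in M. 0 \<le> g x"
proof -
  note [measurable] = L1_measurable[OF g]
  let ?k = "\<lambda>x. if g x < 0 then 1 else 0 :: real"
  have k: "?k \<in> Linf M" by (rule Linf_indicator_Collect) measurable
  have kg: "integrable M (\<lambda>x. ?k x * g x)" using Linf_times_L1[OF k g] by (simp add: L1_def)
  have eq: "norm_L1 M (\<lambda>x. ?k x * g x) = - pairing M ?k g"
    unfolding norm_L1_def pairing_def
    by (subst integral_minus[symmetric], intro Bochner_Integration.integral_cong) auto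
  have "norm_L1 M (\<lambda>x. ?k x * g x) = 0"
    using eq pos[OF k] norm_L1_nonneg[of M "\<lambda>x. ?k x * g x"] by fastforce
  from norm_L1_eq_0[OF Linf_times_L1[OF k g] this] show ?thesis
    by eventually_elim (auto split: if_splits)
qed

text \<open>By \<open>\<sigma>\<close>-finiteness there is a strictly positive integrable \<open>w\<close>. Multiplication with it turns
  bounded test functions into integrable ones and does not change signs, which reduces the claim to
  its counterpart for \<open>h w\<close> in \<open>L\<^sup>1\<close>.\<close>

lemma Linf_nonnegI:
  assumes M: "sigma_finite_measure M" and h: "h \<in> Linf M"
    and pos: "\<And>g. g \<in> L1 M \<Longrightarrow> AE x in M. 0 \<le> g x \<Longrightarrow> 0 \<le> pairing M h g"
  shows "AE x in M. 0 \<le> h x"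
proof -
  obtain w :: "'a \<Rightarrow> real" where w: "w \<in> borel_measurable M" "\<And>x. w x > 0" "integrable M w"
    using sigma_finite_measure.obtain_positive_integrable_function[OF M] by metis
  have wL: "w \<in> L1 M" using w by (simp add: L1_def)
  have "AE x in M. 0 \<le> h x * w x"
  proof (rule L1_nonnegI[OF Linf_times_L1[OF h wL]])
    fix k :: "'a \<Rightarrow> real" assume k: "k \<in> Linf M" "\<And>x. 0 \<le> k x"
    have "0 \<le> pairing M h (\<lambda>x. k x * w x)"
      using w(2) k by (intro pos Linf_times_L1 wL) (auto simp: less_imp_le)
    also have "\<dots> = pairing M k (\<lambda>x. h x * w x)"
      by (simp add: pairing_def mult.left_commute)
    finally show "0 \<le> pairing M k (\<lambda>x. h x * w x)" .
  qed
  then show ?thesis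
  proof eventually_elim
    case (elim x)
    then show ?case using w(2)[of x] by (simp add: zero_le_mult_iff)
  qed
qed

lemma Linf_eqI:
  assumes M: "sigma_finite_measure M" and f: "f \<in> Linf M" and h: "h \<in> Linf M"
    and eq: "\<And>g. g \<in> L1 M \<Longrightarrow> pairing M f g = pairing M h g"
  shows "AE x in M. f x = h x"
proof -
  have d: "(\<lambda>x. a * f x + (- a) * h x) \<in> Linf M" for a by (rule Linf_lin[OF f h])
  have "AE x in M. 0 \<le> a * f x + (- a) * h x" for a :: real
  proof (rule Linf_nonnegI[OF M d])
    fix g assume "g \<in> L1 M"
    then show "0 \<le> pairing M (\<lambda>x. a * f x + (- a) * h x) g"
      using pairing_left_lin[OF f h, of g a "- a"] eq by simp
  qed
  from this[of 1] this[of "-1"] show ?thesis by eventually_elim simp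
qed

section \<open>Stochastic operators\<close>

lemma L1_pos_neg:
  assumes "g \<in> L1 M"
  shows "(\<lambda>x. max 0 (g x)) \<in> L1 M" "(\<lambda>x. max 0 (- g x)) \<in> L1 M"
  using assms by (auto simp: L1_def)

text \<open>Writing an integrable function as a difference of nonnegative ones reduces linear identities to
  nonnegative test functions.\<close>

lemma pairing_eq_if_eq_on_nonneg:
  assumes f: "f \<in> Linf M" and k: "k \<in> Linf M" and g: "g \<in> L1 M"
    and eq: "\<And>g. g \<in> L1 M \<Longrightarrow> AE x in M. 0 \<le> g x \<Longrightarrow> pairing M f g = pairing M k g"
  shows "pairing M f g = pairing M k g"
proof -
  let ?p = "\<lambda>x. max 0 (g x)" and ?n = "\<lambda>x. max 0 (- g x)"
  have "g = (\<lambda>x. ?p x - ?n x)" by auto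
  then have "pairing M h g = pairing M h ?p - pairing M h ?n" if "h \<in> Linf M" for h
    using pairing_right_diff[OF that L1_pos_neg[OF g]] by simp
  then show ?thesis using eq L1_pos_neg[OF g] f k by simp
qed

lemma stochastic_L1: "stochastic_operator M T \<Longrightarrow> g \<in> L1 M \<Longrightarrow> T g \<in> L1 M"
  by (simp add: stochastic_operator_def bounded_linear_L1_def)

lemma stochastic_lin:
  "stochastic_operator M T \<Longrightarrow> g \<in> L1 M \<Longrightarrow> h \<in> L1 M \<Longrightarrow>
    AE x in M. T (\<lambda>x. a * g x + b * h x) x = a * T g x + b * T h x"
  by (simp add: stochastic_operator_def bounded_linear_L1_def ae_eq_def)

lemma stochastic_diff:
  assumes "stochastic_operator M T" "g \<in> L1 M" "h \<in> L1 M"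
  shows "AE x in M. T (\<lambda>x. g x - h x) x = T g x - T h x"
  using stochastic_lin[OF assms, of 1 "-1"] by simp

lemma stochastic_scale:
  assumes "stochastic_operator M T" "g \<in> L1 M"
  shows "AE x in M. T (\<lambda>x. a * g x) x = a * T g x"
  using stochastic_lin[OF assms assms(2), of a 0] by simp

lemma stochastic_cong:
  "stochastic_operator M T \<Longrightarrow> g \<in> L1 M \<Longrightarrow> h \<in> L1 M \<Longrightarrow> AE x in M. g x = h x \<Longrightarrow>
    AE x in M. T g x = T h x"
  by (simp add: stochastic_operator_def bounded_linear_L1_def ae_eq_def)

lemma prob_distribution_normalize:
  assumes g: "g \<in> L1 M" and pos: "AE x in M. 0 \<le> g x" and nz: "norm_L1 M g \<noteq> 0"
  shows "prob_distribution M (\<lambda>x. inverse (norm_L1 M g) * g x)"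
  unfolding prob_distribution_def
proof (intro conjI)
  have n: "0 < norm_L1 M g" using nz norm_L1_nonneg[of M g] by simp
  show "AE x in M. 0 \<le> inverse (norm_L1 M g) * g x"
    using pos by eventually_elim (use n in auto)
  show "norm_L1 M (\<lambda>x. inverse (norm_L1 M g) * g x) = 1" using n by (simp add: norm_L1_scale)
qed (rule L1_scale[OF g])

text \<open>By normalization, what is known about probability distributions carries over to all
  nonnegative functions; functions of norm zero, which cannot be normalized, are treated through
  linearity.\<close>

lemma stochastic_nonneg:
  assumes T: "stochastic_operator M T" and g: "g \<in> L1 M" and pos: "AE x in M. 0 \<le> g x"
  shows "AE x in M. 0 \<le> T g x" "norm_L1 M (T g) = norm_L1 M g"
proof -
  have "(AE x in M. 0 \<le> T g x) \<and> norm_L1 M (T g) = norm_L1 M g"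
  proof (cases "norm_L1 M g = 0")
    case True
    have "AE x in M. T g x = T (\<lambda>x. 0 * g x) x"
      using norm_L1_eq_0[OF g True]
      by (intro stochastic_cong[OF T g L1_scale[OF g]]) simp
    then have z: "AE x in M. T g x = 0"
      using stochastic_scale[OF T g, of 0] by eventually_elim simp
    then have "norm_L1 M (T g) = norm_L1 M (\<lambda>x. 0)"
      by (intro norm_L1_cong stochastic_L1[OF T g]) (auto simp: L1_def)
    moreover have "AE x in M. 0 \<le> T g x" using z by eventually_elim simp
    ultimately show ?thesis using True by (simp add: norm_L1_def)
  next
    case False
    define n where "n = norm_L1 M g"
    have n: "0 < n" using False norm_L1_nonneg[of M g] by (simp add: n_def)
    let ?g = "\<lambda>x. inverse n * g x"
    have "prob_distribution M ?g"
      unfolding n_def by (rule prob_distribution_normalize[OF g pos False])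
    then have p: "prob_distribution M (T ?g)" using T by (simp add: stochastic_operator_def)
    have s: "AE x in M. T ?g x = inverse n * T g x" by (rule stochastic_scale[OF T g])
    have "norm_L1 M (T ?g) = norm_L1 M (\<lambda>x. inverse n * T g x)"
      using s p by (intro norm_L1_cong L1_scale stochastic_L1[OF T g]) (auto simp: prob_distribution_def)
    then have "norm_L1 M (T g) = n"
      using p n unfolding prob_distribution_def by (simp only: norm_L1_scale) (simp add: field_simps)
    moreover have "AE x in M. 0 \<le> T ?g x" using p by (simp add: prob_distribution_def)
    with s have "AE x in M. 0 \<le> T g x"
      by eventually_elim (use n in \<open>auto simp: zero_le_mult_iff\<close>)
    ultimately show ?thesis by (simp add: n_def)
  qed
  then show "AE x in M. 0 \<le> T g x" "norm_L1 M (T g) = norm_L1 M g" by auto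
qed

lemma pairing_1_nonneg:
  assumes "g \<in> L1 M" "AE x in M. 0 \<le> g x"
  shows "pairing M (\<lambda>x. 1) g = norm_L1 M g"
  unfolding pairing_def norm_L1_def
proof (rule integral_cong_AE)
  show "AE x in M. 1 * g x = \<bar>g x\<bar>" using assms(2) by eventually_elim simp
qed (use assms in \<open>auto dest: L1_measurable\<close>)

lemma stochastic_integral:
  assumes T: "stochastic_operator M T" and g: "g \<in> L1 M"
  shows "pairing M (\<lambda>x. 1) (T g) = pairing M (\<lambda>x. 1) g"
proof -
  let ?p = "\<lambda>x. max 0 (g x)" and ?n = "\<lambda>x. max 0 (- g x)"
  note L = L1_pos_neg[OF g]
  have g_eq: "g = (\<lambda>x. ?p x - ?n x)" by auto
  have nonneg: "pairing M (\<lambda>x. 1) (T h) = pairing M (\<lambda>x. 1) h"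
    if "h \<in> L1 M" "AE x in M. 0 \<le> h x" for h
    using stochastic_nonneg[OF T that] that
    by (simp add: pairing_1_nonneg stochastic_L1[OF T])
  have "AE x in M. T g x = T ?p x - T ?n x"
    using stochastic_diff[OF T L] g_eq by simp
  then have "pairing M (\<lambda>x. 1) (T g) = pairing M (\<lambda>x. 1) (\<lambda>x. T ?p x - T ?n x)"
    by (intro pairing_right_cong Linf_const stochastic_L1[OF T] g L1_diff L)
  also have "\<dots> = pairing M (\<lambda>x. 1) (T ?p) - pairing M (\<lambda>x. 1) (T ?n)"
    by (intro pairing_right_diff Linf_const stochastic_L1[OF T] L)
  also have "\<dots> = pairing M (\<lambda>x. 1) ?p - pairing M (\<lambda>x. 1) ?n" using L by (simp add: nonneg)
  also have "\<dots> = pairing M (\<lambda>x. 1) g"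
    by (subst g_eq, rule pairing_right_diff[symmetric]) (intro Linf_const L)+
  finally show ?thesis .
qed

lemma stochastic_contraction:
  assumes T: "stochastic_operator M T" and g: "g \<in> L1 M"
  shows "norm_L1 M (T g) \<le> norm_L1 M g"
proof -
  let ?p = "\<lambda>x. max 0 (g x)" and ?n = "\<lambda>x. max 0 (- g x)"
  note L = L1_pos_neg[OF g]
  have g_eq: "g = (\<lambda>x. ?p x - ?n x)" by auto
  have "AE x in M. T g x = T ?p x - T ?n x"
    using stochastic_diff[OF T L] g_eq by simp
  then have "norm_L1 M (T g) = norm_L1 M (\<lambda>x. T ?p x - T ?n x)"
    by (intro norm_L1_cong stochastic_L1[OF T] g L1_diff L)
  also have "\<dots> \<le> norm_L1 M (T ?p) + norm_L1 M (T ?n)"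
    by (intro norm_L1_triangle stochastic_L1[OF T] L)
  also have "\<dots> = norm_L1 M ?p + norm_L1 M ?n"
    using stochastic_nonneg(2)[OF T L(1)] stochastic_nonneg(2)[OF T L(2)] by simp
  also have "\<dots> = (\<integral>x. \<bar>?p x\<bar> + \<bar>?n x\<bar> \<partial>M)"
    unfolding norm_L1_def using L
    by (intro Bochner_Integration.integral_add[symmetric]) (auto simp: L1_def)
  also have "\<dots> = norm_L1 M g"
    unfolding norm_L1_def by (intro Bochner_Integration.integral_cong) auto
  finally show ?thesis .
qed

lemma stochastic_norm_diff:
  assumes T: "stochastic_operator M T" and g: "g \<in> L1 M" and h: "h \<in> L1 M"
  shows "norm_L1 M (\<lambda>x. T g x - T h x) \<le> norm_L1 M (\<lambda>x. g x - h x)"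
proof -
  have "norm_L1 M (\<lambda>x. T g x - T h x) = norm_L1 M (T (\<lambda>x. g x - h x))"
    using stochastic_diff[OF T g h]
    by (intro norm_L1_cong L1_diff stochastic_L1[OF T] g h) auto
  then show ?thesis using stochastic_contraction[OF T L1_diff[OF g h]] by simp
qed

lemma stochastic_pairing_LIMSEQ:
  assumes T: "stochastic_operator M T" and f: "f \<in> Linf M"
    and G: "\<And>n. G n \<in> L1 M" and g: "g \<in> L1 M"
    and lim: "(\<lambda>n. norm_L1 M (\<lambda>x. G n x - g x)) \<longlonglongrightarrow> 0"
  shows "(\<lambda>n. pairing M f (T (G n))) \<longlonglongrightarrow> pairing M f (T g)"
proof (rule pairing_tendsto[where P = "\<lambda>_. True"])
  show "(\<lambda>n. norm_L1 M (\<lambda>x. T (G n) x - T g x)) \<longlonglongrightarrow> 0"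
    by (rule Lim_null_comparison[OF _ lim])
      (simp add: norm_L1_nonneg stochastic_norm_diff[OF T G g])
qed (use f g G stochastic_L1[OF T] in auto)

lemma pairing_stochastic_lin:
  assumes T: "stochastic_operator M T" and f: "f \<in> Linf M" and g: "g \<in> L1 M" and h: "h \<in> L1 M"
  shows "pairing M f (T (\<lambda>x. a * g x + b * h x)) = a * pairing M f (T g) + b * pairing M f (T h)"
proof -
  have "pairing M f (T (\<lambda>x. a * g x + b * h x)) = pairing M f (\<lambda>x. a * T g x + b * T h x)"
    by (intro pairing_right_cong f stochastic_L1[OF T] L1_lin g h stochastic_lin[OF T])
  also have "\<dots> = a * pairing M f (T g) + b * pairing M f (T h)"
    by (intro pairing_right_lin f stochastic_L1[OF T] g h)
  finally show ?thesis .
qed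

section \<open>Representing positive functionals on bounded functions\<close>

text \<open>A positive linear functional on \<open>L\<^sup>\<infinity>\<close> which is continuous along bounded pointwise limits is
  given by an integrable density: its values on indicators form a finite measure that is absolutely
  continuous, so the Radon--Nikodym theorem applies. Both objects that have to be constructed
  later, the dual of a stochastic operator and the time integral of an orbit, come from here. For
  the latter this avoids any integration theory for functions with values in \<open>L\<^sup>1\<close>.\<close>

lemma normal_functional_representation:
  fixes \<Phi> :: "('a \<Rightarrow> real) \<Rightarrow> real"
  assumes M: "sigma_finite_measure M"
    and lin: "\<And>k l a b. k \<in> Linf M \<Longrightarrow> l \<in> Linf M \<Longrightarrow> \<Phi> (\<lambda>x. a * k x + b * l x) = a * \<Phi> k + b * \<Phi> l"
    and pos: "\<And>k. k \<in> Linf M \<Longrightarrow> AE x in M. 0 \<le> k x \<Longrightarrow> 0 \<le> \<Phi> k"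
    and cont: "\<And>K k C. (\<And>n. K n \<in> Linf M) \<Longrightarrow> k \<in> Linf M \<Longrightarrow>
      (\<And>n x. x \<in> space M \<Longrightarrow> \<bar>K n x\<bar> \<le> C) \<Longrightarrow> (\<And>x. x \<in> space M \<Longrightarrow> (\<lambda>n. K n x) \<longlonglongrightarrow> k x) \<Longrightarrow>
      (\<lambda>n. \<Phi> (K n)) \<longlonglongrightarrow> \<Phi> k"
  shows "\<exists>d\<in>L1 M. \<forall>k\<in>Linf M. \<Phi> k = pairing M k d"
proof -
  have diff: "\<Phi> (\<lambda>x. k x - l x) = \<Phi> k - \<Phi> l" if "k \<in> Linf M" "l \<in> Linf M" for k l
    using lin[OF that, of 1 "-1"] by simp
  have add: "\<Phi> (\<lambda>x. k x + l x) = \<Phi> k + \<Phi> l" if "k \<in> Linf M" "l \<in> Linf M" for k l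
    using lin[OF that, of 1 1] by simp
  have scale: "\<Phi> (\<lambda>x. a * k x) = a * \<Phi> k" if "k \<in> Linf M" for k a
    using lin[OF that that, of a 0] by simp
  have cong: "\<Phi> k = \<Phi> l" if kl: "k \<in> Linf M" "l \<in> Linf M" "AE x in M. k x = l x" for k l
  proof -
    have "0 \<le> \<Phi> k - \<Phi> l"
      unfolding diff[OF kl(1,2), symmetric] using Linf_lin[OF kl(1,2), of 1 "-1"] kl(3)
      by (intro pos) auto
    moreover have "0 \<le> \<Phi> l - \<Phi> k"
      unfolding diff[OF kl(2,1), symmetric] using Linf_lin[OF kl(2,1), of 1 "-1"] kl(3)
      by (intro pos) auto
    ultimately show ?thesis by simp
  qed
  have zero: "\<Phi> (\<lambda>x. 0) = 0" using scale[OF Linf_const, of 0 0] by simp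
  have "indicator {} = (\<lambda>x::'a. 0 :: real)" by auto
  then have zero_ind: "\<Phi> (indicator {}) = 0" using zero by simp
  have ind: "indicator E \<in> Linf M" if "E \<in> sets M" for E
    using that by (intro Linf_I[where C = 1]) (auto simp: indicator_def)
  define N where "N = measure_of (space M) (sets M) (\<lambda>E. ennreal (\<Phi> (indicator E)))"
  have sets_N: "sets N = sets M" and space_N: "space N = space M"
    by (simp_all add: N_def)
  have \<Phi>_ind_pos: "0 \<le> \<Phi> (indicator E)" if "E \<in> sets M" for E
    by (rule pos[OF ind[OF that]]) simp
  have sums: "(\<lambda>i. \<Phi> (indicator (F i))) sums \<Phi> (indicator (\<Union>i. F i))"
    if F: "range F \<subseteq> sets M" "disjoint_family F" for F
  proof -
    have Fs: "F i \<in> sets M" for i using F by auto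
    have fin: "(\<Sum>i<n. \<Phi> (indicator (F i))) = \<Phi> (\<lambda>x. \<Sum>i<n. indicator (F i) x)
      \<and> (\<lambda>x. \<Sum>i<n. indicator (F i) x :: real) \<in> Linf M" for n
    proof (induction n)
      case 0
      then show ?case by (simp add: zero Linf_const)
    next
      case (Suc n)
      then have L: "(\<lambda>x. \<Sum>i<n. indicator (F i) x :: real) \<in> Linf M" by simp
      show ?case
        using Suc add[OF L ind[OF Fs[of n]]] Linf_lin[OF L ind[OF Fs[of n]], of 1 1] by simp
    qed
    have part: "(\<Sum>i<n. indicator (F i) x :: real) = indicator (\<Union>i<n. F i) x" for n x
      by (rule indicator_UN_disjoint[symmetric])
        (use F in \<open>auto simp: disjoint_family_on_def\<close>)
    have "(\<lambda>n. \<Phi> (\<lambda>x. \<Sum>i<n. indicator (F i) x)) \<longlonglongrightarrow> \<Phi> (indicator (\<Union>i. F i))"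
    proof (rule cont[where C = 1])
      show "indicator (\<Union>i. F i) \<in> Linf M" using Fs by (intro ind) auto
      show "(\<lambda>n. \<Sum>i<n. indicator (F i) x) \<longlonglongrightarrow> (indicator (\<Union>i. F i) x :: real)" for x
        unfolding part by (rule LIMSEQ_indicator_UN)
      show "\<bar>\<Sum>i<n. indicator (F i) x :: real\<bar> \<le> 1" for n x
        unfolding part by (simp add: indicator_def)
    qed (use fin in auto)
    then show ?thesis unfolding sums_def using fin by simp
  qed
  have emeasure_N: "emeasure N E = ennreal (\<Phi> (indicator E))" if "E \<in> sets M" for E
  proof (rule emeasure_measure_of[OF N_def])
    show "sets M \<subseteq> Pow (space M)" by (rule sets.space_closed)
    show "positive (sets N) (\<lambda>E. ennreal (\<Phi> (indicator E)))"
      by (simp add: positive_def zero_ind)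
    show "countably_additive (sets N) (\<lambda>E. ennreal (\<Phi> (indicator E)))"
    proof (rule countably_additiveI)
      fix F :: "nat \<Rightarrow> 'a set"
      assume F: "range F \<subseteq> sets N" "disjoint_family F"
      have nn: "0 \<le> \<Phi> (indicator (F i))" for i
        using F sets_N by (intro \<Phi>_ind_pos) auto
      have s: "(\<lambda>i. \<Phi> (indicator (F i))) sums \<Phi> (indicator (\<Union>i. F i))"
        using F sets_N by (intro sums) auto
      show "(\<Sum>i. ennreal (\<Phi> (indicator (F i)))) = ennreal (\<Phi> (indicator (\<Union>i. F i)))"
        using suminf_ennreal2[OF nn sums_summable[OF s]] sums_unique[OF s] by simp
    qed
    show "E \<in> sets N" using that sets_N by simp
  qed
  have ac: "absolutely_continuous M N"
    unfolding absolutely_continuous_def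
  proof
    fix E assume E: "E \<in> null_sets M"
    then have "\<Phi> (indicator E) = \<Phi> (\<lambda>x. 0)"
      using AE_not_in[OF E] by (intro cong ind Linf_const) (auto elim!: eventually_mono)
    then show "E \<in> null_sets N"
      using E emeasure_N sets_N zero by (auto simp: null_sets_def)
  qed
  interpret N: finite_measure N
    by (rule finite_measureI) (simp add: space_N emeasure_N)
  obtain d where d [measurable]: "d \<in> borel_measurable M"
    and RN: "AE x in M. RN_deriv M N x = ennreal (d x)" and d_pos: "\<And>x. 0 \<le> d x"
    using sigma_finite_measure.real_RN_deriv[OF M N.finite_measure_axioms ac sets_N] by metis
  have meas: "(\<integral>\<^sup>+x. ennreal (d x * indicator E x) \<partial>M) = ennreal (\<Phi> (indicator E))"
    if [measurable]: "E \<in> sets M" for E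
  proof -
    have "ennreal (\<Phi> (indicator E)) = emeasure (density M (RN_deriv M N)) E"
      using emeasure_N that sigma_finite_measure.density_RN_deriv[OF M ac sets_N] by simp
    also have "\<dots> = (\<integral>\<^sup>+x. RN_deriv M N x * indicator E x \<partial>M)"
      by (rule emeasure_density) auto
    also have "\<dots> = (\<integral>\<^sup>+x. ennreal (d x * indicator E x) \<partial>M)"
      using RN by (intro nn_integral_cong_AE)
        (auto elim!: eventually_mono simp: ennreal_mult' ennreal_indicator d_pos)
    finally show ?thesis by simp
  qed
  have dL: "d \<in> L1 M"
  proof -
    have "(\<integral>\<^sup>+x. ennreal (d x) \<partial>M) = (\<integral>\<^sup>+x. ennreal (d x * indicator (space M) x) \<partial>M)"
      by (rule nn_integral_cong) simp
    also have "\<dots> < \<infinity>" unfolding meas[OF sets.top] by simp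
    finally show ?thesis
      unfolding L1_def using d_pos by (auto intro: integrableI_nonneg)
  qed
  have ind_eq: "\<Phi> (indicator E) = pairing M (indicator E) d" if "E \<in> sets M" for E
  proof -
    have "pairing M (indicator E) d = enn2real (\<integral>\<^sup>+x. ennreal (d x * indicator E x) \<partial>M)"
      unfolding pairing_def using that d_pos
      by (subst integral_eq_nn_integral) (auto simp: mult.commute)
    then show ?thesis using meas[OF that] \<Phi>_ind_pos[OF that] by simp
  qed
  \<comment> \<open>Boundedness is part of the induction statement because the approximating functions inherit it
    from their limit only.\<close>
  have nonneg_eq: "(\<forall>x\<in>space M. u x \<le> C) \<longrightarrow> \<Phi> u = pairing M u d"
    if u: "u \<in> borel_measurable M" "\<And>x. 0 \<le> u x" for u C
    using u
  proof (induction arbitrary: C rule: borel_measurable_induct_real)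
    case (set E)
    then show ?case by (simp add: ind_eq)
  next
    case (mult u c)
    show ?case
    proof (cases "c = 0")
      case True
      then show ?thesis by (simp add: zero pairing_def)
    next
      case False
      show ?thesis
      proof
        assume "\<forall>x\<in>space M. c * u x \<le> C"
        then have b: "\<forall>x\<in>space M. u x \<le> C / c" using False mult.hyps by (simp add: field_simps)
        then have "u \<in> Linf M" using mult.hyps by (intro Linf_I[where C = "C / c"]) auto
        then show "\<Phi> (\<lambda>x. c * u x) = pairing M (\<lambda>x. c * u x) d"
          using mult.IH b scale pairing_left_lin[OF _ _ dL, of u u c 0] by simp
      qed
    qed
  next
    case (add u v)
    show ?case
    proof
      assume b: "\<forall>x\<in>space M. v x + u x \<le> C"
      have bu: "\<forall>x\<in>space M. u x \<le> C" and bv: "\<forall>x\<in>space M. v x \<le> C"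
        using b add.hyps by (smt (verit))+
      have L: "u \<in> Linf M" "v \<in> Linf M"
        using bu bv add.hyps by (auto intro!: Linf_I[where C = C])
      show "\<Phi> (\<lambda>x. v x + u x) = pairing M (\<lambda>x. v x + u x) d"
        using lin[OF L(2,1), of 1 1] pairing_left_lin[OF L(2,1) dL, of 1 1] add.IH bu bv by simp
    qed
  next
    case (seq U)
    show ?case
    proof
      assume b: "\<forall>x\<in>space M. u x \<le> C"
      have le: "U i x \<le> C" if "x \<in> space M" for i x
      proof -
        have "incseq (\<lambda>i. U i x)" using seq.hyps by (auto simp: incseq_def le_fun_def)
        then have "U i x \<le> u x" using seq.hyps that by (intro incseq_le) auto
        then show ?thesis using b that by fastforce
      qed
      have L: "U i \<in> Linf M" for i
        using seq.hyps le by (intro Linf_I[where C = C]) auto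
      have Lu: "u \<in> Linf M" using u b by (intro Linf_I[where C = C]) auto
      have "(\<lambda>i. \<Phi> (U i)) \<longlonglongrightarrow> \<Phi> u"
        using seq.hyps le by (intro cont[where C = C] L Lu) (auto simp: abs_of_nonneg)
      moreover have "(\<lambda>i. pairing M (U i) d) \<longlonglongrightarrow> pairing M u d"
        unfolding pairing_def
      proof (rule integral_dominated_convergence[where w = "\<lambda>x. C * d x"])
        show "AE x in M. (\<lambda>i. U i x * d x) \<longlonglongrightarrow> u x * d x"
          using seq.hyps by (auto intro!: tendsto_mult)
        show "AE x in M. norm (U i x * d x) \<le> C * d x" for i
          using seq.hyps le d_pos by (auto simp: abs_mult intro!: mult_right_mono)
      qed (use dL L[THEN Linf_measurable] Lu[THEN Linf_measurable] in \<open>auto simp: L1_def\<close>)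
      moreover have "\<Phi> (U i) = pairing M (U i) d" for i
        using seq.IH le by auto
      ultimately show "\<Phi> u = pairing M u d" using LIMSEQ_unique by fastforce
    qed
  qed
  have "\<Phi> k = pairing M k d" if k: "k \<in> Linf M" for k
  proof -
    obtain C where C: "0 \<le> C" "AE x in M. \<bar>k x\<bar> \<le> C" using Linf_bound[OF k] by blast
    note [measurable] = Linf_measurable[OF k]
    let ?u = "\<lambda>x. max 0 (min (2 * C) (k x + C))"
    have u: "?u \<in> Linf M" using C(1) by (intro Linf_I[where C = "2 * C"]) auto
    have "\<Phi> ?u = pairing M ?u d" using nonneg_eq[of ?u "2 * C"] C(1) by auto
    moreover have "\<Phi> (\<lambda>x. 1) = pairing M (\<lambda>x. 1) d" using nonneg_eq[of "\<lambda>x. 1" 1] by auto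
    moreover have ae: "AE x in M. k x = 1 * ?u x + (- C) * 1"
      using C(2) by eventually_elim (auto simp: max_def min_def)
    moreover have L: "(\<lambda>x. 1 * ?u x + (- C) * 1) \<in> Linf M" by (rule Linf_lin[OF u Linf_const])
    ultimately show ?thesis
      using cong[OF k L ae] pairing_left_cong[OF k L dL ae]
        lin[OF u Linf_const[of 1], of 1 "- C"] pairing_left_lin[OF u Linf_const[of 1] dL, of 1 "- C"]
      by simp
  qed
  then show ?thesis using dL by blast
qed

section \<open>Dual operators\<close>

text \<open>Let \<open>w\<close> be a strictly positive integrable weight. For nonnegative \<open>f\<close> the functional
  \<open>k \<mapsto> \<langle>f, T (k w)\<rangle>\<close> on \<open>L\<^sup>\<infinity>\<close> has an integrable density \<open>d\<close>, and \<open>d / w\<close> is the image of \<open>f\<close>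
  under the dual of \<open>T\<close>. A general \<open>f\<close> becomes nonnegative after adding a constant \<open>C\<close>, which is
  subtracted again at the end: because \<open>T\<close> preserves integrals, its dual fixes constants.\<close>

lemma dual_exists:
  assumes M: "sigma_finite_measure M" and T: "stochastic_operator M T" and f: "f \<in> Linf M"
  shows "\<exists>h\<in>Linf M. \<forall>g\<in>L1 M. pairing M f (T g) = pairing M h g"
proof -
  obtain C where C: "0 \<le> C" "AE x in M. \<bar>f x\<bar> \<le> C" using Linf_bound[OF f] by blast
  obtain w :: "'a \<Rightarrow> real" where w: "w \<in> borel_measurable M" "\<And>x. w x > 0" "integrable M w"
    using sigma_finite_measure.obtain_positive_integrable_function[OF M] by metis
  have w_L1: "w \<in> L1 M" using w by (simp add: L1_def)
  define F where "F = (\<lambda>x. 1 * f x + C * 1)"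
  have F: "F \<in> Linf M" unfolding F_def by (rule Linf_lin[OF f Linf_const])
  have F_pos: "AE x in M. 0 \<le> F x" and F_le: "AE x in M. 0 \<le> (2 * C) * 1 + (-1) * F x"
    using C(2) by (eventually_elim, simp add: F_def)+
  have kw: "(\<lambda>x. k x * w x) \<in> L1 M" if "k \<in> Linf M" for k
    using that w_L1 by (rule Linf_times_L1)
  have kw_pos: "AE x in M. 0 \<le> T (\<lambda>x. k x * w x) x" if "k \<in> Linf M" "AE x in M. 0 \<le> k x" for k
  proof (rule stochastic_nonneg(1)[OF T kw[OF that(1)]])
    show "AE x in M. 0 \<le> k x * w x"
      using that(2) by eventually_elim (simp add: w(2) less_imp_le)
  qed
  have "\<exists>d\<in>L1 M. \<forall>k\<in>Linf M. pairing M F (T (\<lambda>x. k x * w x)) = pairing M k d"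
  proof (rule normal_functional_representation[OF M])
    fix k l :: "'a \<Rightarrow> real" and a b :: real
    assume kl: "k \<in> Linf M" "l \<in> Linf M"
    show "pairing M F (T (\<lambda>x. (a * k x + b * l x) * w x)) =
        a * pairing M F (T (\<lambda>x. k x * w x)) + b * pairing M F (T (\<lambda>x. l x * w x))"
      using pairing_stochastic_lin[OF T F kw[OF kl(1)] kw[OF kl(2)], of a b]
      by (simp add: algebra_simps)
  next
    fix k :: "'a \<Rightarrow> real" assume "k \<in> Linf M" "AE x in M. 0 \<le> k x"
    then show "0 \<le> pairing M F (T (\<lambda>x. k x * w x))"
      by (intro pairing_nonneg F_pos kw_pos)
  next
    fix K :: "nat \<Rightarrow> 'a \<Rightarrow> real" and k B
    assume K: "\<And>n. K n \<in> Linf M" "k \<in> Linf M" and b: "\<And>n x. x \<in> space M \<Longrightarrow> \<bar>K n x\<bar> \<le> B"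
      and lim: "\<And>x. x \<in> space M \<Longrightarrow> (\<lambda>n. K n x) \<longlonglongrightarrow> k x"
    have "(\<lambda>n. norm_L1 M (\<lambda>x. K n x * w x - k x * w x)) \<longlonglongrightarrow> 0"
    proof (rule norm_L1_dominated_convergence[where w = "\<lambda>x. B * w x"])
      show "AE x in M. \<bar>K n x * w x\<bar> \<le> B * w x" for n
        using b w(2) by (auto simp: abs_mult less_imp_le intro!: mult_right_mono)
      show "AE x in M. (\<lambda>n. K n x * w x) \<longlonglongrightarrow> k x * w x"
        using lim by (auto intro!: tendsto_mult)
    qed (use K kw w_L1 L1_scale in auto)
    then show "(\<lambda>n. pairing M F (T (\<lambda>x. K n x * w x))) \<longlonglongrightarrow> pairing M F (T (\<lambda>x. k x * w x))"
      by (intro stochastic_pairing_LIMSEQ[OF T F] kw K)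
  qed
  then obtain d where d: "d \<in> L1 M"
    and rep: "\<And>k. k \<in> Linf M \<Longrightarrow> pairing M F (T (\<lambda>x. k x * w x)) = pairing M k d"
    by blast
  have d_pos: "AE x in M. 0 \<le> d x"
  proof (rule L1_nonnegI[OF d])
    fix k :: "'a \<Rightarrow> real" assume k: "k \<in> Linf M" "\<And>x. 0 \<le> k x"
    show "0 \<le> pairing M k d"
      unfolding rep[OF k(1), symmetric] using k by (intro pairing_nonneg F_pos kw_pos) auto
  qed
  \<comment> \<open>Since the operator preserves integrals, the bound \<open>2 C\<close> on \<open>F\<close> passes to \<open>d / w\<close>.\<close>
  have d_le: "AE x in M. 0 \<le> (2 * C) * w x + (-1) * d x"
  proof (rule L1_nonnegI[OF L1_lin[OF w_L1 d]])
    fix k :: "'a \<Rightarrow> real" assume k: "k \<in> Linf M" "\<And>x. 0 \<le> k x"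
    have "0 \<le> pairing M (\<lambda>x. (2 * C) * 1 + (-1) * F x) (T (\<lambda>x. k x * w x))"
      using k by (intro pairing_nonneg F_le kw_pos) auto
    also have "\<dots> = (2 * C) * pairing M (\<lambda>x. 1) (\<lambda>x. k x * w x) - pairing M k d"
      using pairing_left_lin[OF Linf_const F stochastic_L1[OF T kw[OF k(1)]], of "2 * C" 1 "-1"]
        stochastic_integral[OF T kw[OF k(1)]] rep[OF k(1)] by simp
    also have "\<dots> = (2 * C) * pairing M k w + (-1) * pairing M k d"
      by (simp add: pairing_def)
    also have "\<dots> = pairing M k (\<lambda>x. (2 * C) * w x + (-1) * d x)"
      using pairing_right_lin[OF k(1) w_L1 d, of "2 * C" "-1"] by simp
    finally show "0 \<le> pairing M k (\<lambda>x. (2 * C) * w x + (-1) * d x)" .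
  qed
  define h where "h = (\<lambda>x. d x / w x)"
  have h: "h \<in> Linf M"
  proof (rule Linf_I[where C = "2 * C"])
    show "h \<in> borel_measurable M" unfolding h_def using w L1_measurable[OF d] by auto
    show "AE x in M. \<bar>h x\<bar> \<le> 2 * C"
      using d_pos d_le
    proof eventually_elim
      case (elim x)
      then show ?case using w(2)[of x] by (simp add: h_def field_simps)
    qed
  qed
  have hw: "h x * w x = d x" for x using w(2)[of x] by (simp add: h_def)
  have main: "pairing M F (T g) = pairing M h g" if g: "g \<in> L1 M" for g
  proof -
    \<comment> \<open>Bounded multiples of \<open>w\<close> are dense: truncate \<open>g / w\<close>.\<close>
    define K where "K = (\<lambda>n::nat. \<lambda>x. max (- real n) (min (real n) (g x / w x)))"
    have K: "K n \<in> Linf M" for n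
      unfolding K_def using w L1_measurable[OF g] by (intro Linf_I[where C = "real n"]) auto
    have K_le: "\<bar>K n x\<bar> \<le> \<bar>g x / w x\<bar>" for n x
      by (auto simp: K_def max_def min_def simp del: abs_divide)
    have lim: "(\<lambda>n. norm_L1 M (\<lambda>x. K n x * w x - g x)) \<longlonglongrightarrow> 0"
    proof (rule norm_L1_dominated_convergence[where w = "\<lambda>x. \<bar>g x\<bar>"])
      have "\<bar>K n x * w x\<bar> \<le> \<bar>g x\<bar>" for n x
        using K_le[of n x] w(2)[of x] by (simp add: abs_mult field_simps)
      then show "AE x in M. \<bar>K n x * w x\<bar> \<le> \<bar>g x\<bar>" for n by simp
      have "(\<lambda>n. K n x * w x) \<longlonglongrightarrow> g x" for x
      proof (rule tendsto_eventually)
        obtain m :: nat where m: "\<bar>g x / w x\<bar> \<le> real m" using real_arch_simple by blast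
        show "\<forall>\<^sub>F n in sequentially. K n x * w x = g x"
          using eventually_ge_at_top[of m]
        proof eventually_elim
          case (elim n)
          then have "\<bar>g x / w x\<bar> \<le> real n" using m by simp
          then have "K n x = g x / w x" by (auto simp: K_def max_def min_def simp del: abs_divide)
          then show ?case using w(2)[of x] by simp
        qed
      qed
      then show "AE x in M. (\<lambda>n. K n x * w x) \<longlonglongrightarrow> g x" by simp
    qed (use K kw g in \<open>auto simp: L1_def\<close>)
    have "(\<lambda>n. pairing M F (T (\<lambda>x. K n x * w x))) \<longlonglongrightarrow> pairing M F (T g)"
      by (rule stochastic_pairing_LIMSEQ[OF T F kw[OF K] g lim])
    moreover have "(\<lambda>n. pairing M h (\<lambda>x. K n x * w x)) \<longlonglongrightarrow> pairing M h g"
      by (rule pairing_tendsto[where P = "\<lambda>_. True", OF h _ g _ lim]) (auto intro: kw K)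
    moreover have "pairing M F (T (\<lambda>x. K n x * w x)) = pairing M h (\<lambda>x. K n x * w x)" for n
      unfolding rep[OF K] by (simp add: pairing_def hw[symmetric] mult.left_commute)
    ultimately show ?thesis using LIMSEQ_unique by fastforce
  qed
  show ?thesis
  proof (intro bexI ballI)
    fix g assume g: "g \<in> L1 M"
    show "pairing M f (T g) = pairing M (\<lambda>x. 1 * h x + (- C) * 1) g"
      using pairing_left_lin[OF h Linf_const[of 1] g, of 1 "- C"] main[OF g]
        pairing_left_lin[OF f Linf_const[of 1] stochastic_L1[OF T g], of 1 C]
        stochastic_integral[OF T g]
      by (simp add: F_def)
  qed (rule Linf_lin[OF h Linf_const])
qed

lemma
  assumes M: "sigma_finite_measure M" and T: "stochastic_operator M T" and f: "f \<in> Linf M"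
  shows dual_op_Linf: "dual_op M T f \<in> Linf M"
    and dual_op_pairing: "g \<in> L1 M \<Longrightarrow> pairing M f (T g) = pairing M (dual_op M T f) g"
proof -
  have "\<exists>h. h \<in> Linf M \<and> (\<forall>g\<in>L1 M. pairing M f (T g) = pairing M h g)"
    using dual_exists[OF M T f] by blast
  from someI_ex[OF this]
  show "dual_op M T f \<in> Linf M"
    and "g \<in> L1 M \<Longrightarrow> pairing M f (T g) = pairing M (dual_op M T f) g"
    unfolding dual_op_def by auto
qed

lemma dual_op_eqI:
  assumes M: "sigma_finite_measure M" and T: "stochastic_operator M T" and f: "f \<in> Linf M"
    and h: "h \<in> Linf M" and eq: "\<And>g. g \<in> L1 M \<Longrightarrow> pairing M f (T g) = pairing M h g"
  shows "AE x in M. dual_op M T f x = h x"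
  by (rule Linf_eqI[OF M dual_op_Linf[OF M T f] h]) (simp add: eq flip: dual_op_pairing[OF M T f])

lemma dual_op_lin:
  assumes M: "sigma_finite_measure M" and T: "stochastic_operator M T"
    and f: "f \<in> Linf M" and k: "k \<in> Linf M"
  shows "AE x in M. dual_op M T (\<lambda>x. a * f x + b * k x) x = a * dual_op M T f x + b * dual_op M T k x"
proof (rule dual_op_eqI[OF M T Linf_lin[OF f k]])
  note V = dual_op_Linf[OF M T]
  show "(\<lambda>x. a * dual_op M T f x + b * dual_op M T k x) \<in> Linf M"
    by (intro Linf_lin V f k)
  fix g assume g: "g \<in> L1 M"
  show "pairing M (\<lambda>x. a * f x + b * k x) (T g) =
      pairing M (\<lambda>x. a * dual_op M T f x + b * dual_op M T k x) g"
    unfolding pairing_left_lin[OF f k stochastic_L1[OF T g]] pairing_left_lin[OF V[OF f] V[OF k] g]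
    by (simp only: dual_op_pairing[OF M T f g] dual_op_pairing[OF M T k g])
qed

lemma dual_op_const:
  assumes M: "sigma_finite_measure M" and T: "stochastic_operator M T"
  shows "AE x in M. dual_op M T (\<lambda>x. 1) x = 1"
  by (rule dual_op_eqI[OF M T Linf_const Linf_const stochastic_integral[OF T]])

lemma dual_op_nonneg:
  assumes M: "sigma_finite_measure M" and T: "stochastic_operator M T"
    and f: "f \<in> Linf M" and pos: "AE x in M. 0 \<le> f x"
  shows "AE x in M. 0 \<le> dual_op M T f x"
proof (rule Linf_nonnegI[OF M dual_op_Linf[OF M T f]])
  fix g assume g: "g \<in> L1 M" "AE x in M. 0 \<le> g x"
  show "0 \<le> pairing M (dual_op M T f) g"
    unfolding dual_op_pairing[OF M T f g(1), symmetric]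
    by (intro pairing_nonneg pos stochastic_nonneg(1)[OF T g])
qed

section \<open>Fixed points of the dual whose squares are fixed\<close>

lemma nonneg_on_rats_imp_nonneg:
  fixes F :: "real \<Rightarrow> real"
  assumes "continuous_on UNIV F" "\<And>r::rat. 0 \<le> F (of_rat r)"
  shows "0 \<le> F x"
proof -
  have "\<And>y. y \<in> \<rat> \<Longrightarrow> 0 \<le> F y" using assms(2) by (auto simp: Rats_def)
  then show ?thesis
    using continuous_ge_on_closure[of \<rat> F x 0] assms(1) by (simp add: Rats_closure_real)
qed

text \<open>Rational parameters make it possible to apply this outside a single null set. With \<open>l\<close> moved
  to \<open>a\<close> the square disappears and the term linear in \<open>s\<close> dominates near \<open>s = 0\<close>; as it takes both
  signs, its coefficient is zero.\<close>

lemma quadratic_nonneg_imp_eq: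
  fixes a b c d :: real
  assumes "\<And>l s :: rat. 0 \<le> (a - of_rat l)\<^sup>2 + 2 * of_rat s * (b - of_rat l * c) + (of_rat s)\<^sup>2 * d"
  shows "b = a * c"
proof -
  have r: "0 \<le> (a - l)\<^sup>2 + 2 * of_rat s * (b - l * c) + (of_rat s)\<^sup>2 * d" for l and s :: rat
    by (rule nonneg_on_rats_imp_nonneg[where x = l]) (intro continuous_intros assms)+
  have "0 \<le> (a - a)\<^sup>2 + 2 * s * (b - a * c) + s\<^sup>2 * d" for s
    by (rule nonneg_on_rats_imp_nonneg[where x = s]) (intro continuous_intros r)+
  then have nn: "0 \<le> 2 * s * (b - a * c) + s\<^sup>2 * d" for s by simp
  define e where "e = b - a * c"
  define D where "D = \<bar>d\<bar> + 1"
  have D: "0 < D" "d \<le> D" by (auto simp: D_def)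
  have "0 \<le> 2 * (- e / D) * e + (- e / D)\<^sup>2 * d" using nn[of "- e / D"] by (simp add: e_def)
  also have "\<dots> \<le> 2 * (- e / D) * e + (- e / D)\<^sup>2 * D"
    using D by (intro add_left_mono mult_left_mono) auto
  also have "\<dots> = - (e\<^sup>2 / D)" using D by (simp add: field_simps power2_eq_square)
  finally have "e\<^sup>2 \<le> 0" using D by (simp add: field_simps)
  then show ?thesis by (simp add: e_def)
qed

text \<open>This is the multiplicative domain argument for positive unital maps. Let \<open>V\<close> be the dual
  operator. By positivity \<open>V ((A - l + s f)\<^sup>2) \<ge> 0\<close>, and since \<open>V\<close> fixes \<open>1\<close>, \<open>A\<close> and \<open>A\<^sup>2\<close>, expanding
  the square turns this into
  \<open>(A - l)\<^sup>2 + 2 s (V (A f) - l V f) + s\<^sup>2 V (f\<^sup>2) \<ge> 0\<close>. Holding for all rational \<open>l\<close> and \<open>s\<close> at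
  almost every point, it forces \<open>V (A f) = A V f\<close> there.\<close>

lemma dual_op_multiplicative:
  assumes M: "sigma_finite_measure M" and T: "stochastic_operator M T"
    and A: "A \<in> Linf M" and f: "f \<in> Linf M"
    and fix1: "AE x in M. dual_op M T A x = A x"
    and fix2: "AE x in M. dual_op M T (\<lambda>x. A x * A x) x = A x * A x"
  shows "AE x in M. dual_op M T (\<lambda>x. A x * f x) x = A x * dual_op M T f x"
proof -
  let ?V = "dual_op M T"
  have "AE x in M. 0 \<le> (A x - of_rat l)\<^sup>2
      + 2 * of_rat s * (?V (\<lambda>x. A x * f x) x - of_rat l * ?V f x) + (of_rat s)\<^sup>2 * ?V (\<lambda>x. f x * f x) x"
    for l s :: rat
  proof -
    define l0 s0 :: real where "l0 = of_rat l" and "s0 = of_rat s"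
    \<comment> \<open>The square is assembled one term at a time so that each step is an instance of binary
      linearity of the dual.\<close>
    define q1 where "q1 = (\<lambda>x. 1 * (A x * A x) + (- 2 * l0) * A x)"
    define q2 where "q2 = (\<lambda>x. 1 * q1 x + l0\<^sup>2 * 1)"
    define q3 where "q3 = (\<lambda>x. 1 * q2 x + (2 * s0) * (A x * f x))"
    define q4 where "q4 = (\<lambda>x. 1 * q3 x + (- 2 * l0 * s0) * f x)"
    define q5 where "q5 = (\<lambda>x. 1 * q4 x + s0\<^sup>2 * (f x * f x))"
    note L = Linf_mult[OF A A] Linf_mult[OF A f] Linf_mult[OF f f] Linf_const[of 1]
    have q1: "q1 \<in> Linf M" unfolding q1_def by (intro Linf_lin L A)
    have q2: "q2 \<in> Linf M" unfolding q2_def by (intro Linf_lin L q1)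
    have q3: "q3 \<in> Linf M" unfolding q3_def by (intro Linf_lin L q2)
    have q4: "q4 \<in> Linf M" unfolding q4_def by (intro Linf_lin L q3 f)
    have q5: "q5 \<in> Linf M" unfolding q5_def by (intro Linf_lin L q4)
    have square: "q5 x = (A x - l0 + s0 * f x)\<^sup>2" for x
      unfolding q5_def q4_def q3_def q2_def q1_def by algebra
    note lin = dual_op_lin[OF M T]
    have "AE x in M. 0 \<le> ?V q5 x" by (intro dual_op_nonneg[OF M T q5]) (simp add: square)
    moreover have "AE x in M. ?V q1 x = 1 * ?V (\<lambda>x. A x * A x) x + (- 2 * l0) * ?V A x"
      unfolding q1_def by (intro lin L A)
    moreover have "AE x in M. ?V q2 x = 1 * ?V q1 x + l0\<^sup>2 * ?V (\<lambda>x. 1) x"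
      unfolding q2_def by (intro lin L q1)
    moreover have "AE x in M. ?V q3 x = 1 * ?V q2 x + (2 * s0) * ?V (\<lambda>x. A x * f x) x"
      unfolding q3_def by (intro lin L q2)
    moreover have "AE x in M. ?V q4 x = 1 * ?V q3 x + (- 2 * l0 * s0) * ?V f x"
      unfolding q4_def by (intro lin L q3 f)
    moreover have "AE x in M. ?V q5 x = 1 * ?V q4 x + s0\<^sup>2 * ?V (\<lambda>x. f x * f x) x"
      unfolding q5_def by (intro lin L q4)
    ultimately show ?thesis
      using fix1 fix2 dual_op_const[OF M T] unfolding l0_def[symmetric] s0_def[symmetric]
      by eventually_elim (simp add: power2_eq_square algebra_simps)
  qed
  then have "AE x in M. \<forall>l s :: rat. 0 \<le> (A x - of_rat l)\<^sup>2
      + 2 * of_rat s * (?V (\<lambda>x. A x * f x) x - of_rat l * ?V f x) + (of_rat s)\<^sup>2 * ?V (\<lambda>x. f x * f x) x"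
    unfolding AE_all_countable by blast
  then show ?thesis by eventually_elim (rule quadratic_nonneg_imp_eq, blast)
qed

lemma commute_iff_dual_commute:
  assumes M: "sigma_finite_measure M" and T: "stochastic_operator M T" and A: "A \<in> Linf M"
  shows "(\<forall>g\<in>L1 M. AE x in M. A x * T g x = T (\<lambda>x. A x * g x) x) \<longleftrightarrow>
    (\<forall>f\<in>Linf M. AE x in M. A x * dual_op M T f x = dual_op M T (\<lambda>x. A x * f x) x)"
    (is "?L \<longleftrightarrow> ?R")
proof -
  note V = dual_op_Linf[OF M T] and TL = stochastic_L1[OF T]
  have "pairing M f (\<lambda>x. A x * T g x) = pairing M (dual_op M T (\<lambda>x. A x * f x)) g"
    if "f \<in> Linf M" "g \<in> L1 M" for f g
    using that by (simp add: dual_op_pairing[OF M T Linf_mult[OF A], symmetric])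
      (simp add: pairing_def algebra_simps)
  moreover have "pairing M f (T (\<lambda>x. A x * g x)) = pairing M (\<lambda>x. A x * dual_op M T f x) g"
    if "f \<in> Linf M" "g \<in> L1 M" for f g
    using that by (simp add: dual_op_pairing[OF M T] Linf_times_L1[OF A])
      (simp add: pairing_def algebra_simps)
  moreover note eqs = calculation
  show ?thesis
  proof
    assume ?L
    show ?R
    proof
      fix f assume f: "f \<in> Linf M"
      show "AE x in M. A x * dual_op M T f x = dual_op M T (\<lambda>x. A x * f x) x"
      proof (rule Linf_eqI[OF M])
        fix g assume g: "g \<in> L1 M"
        have "pairing M f (\<lambda>x. A x * T g x) = pairing M f (T (\<lambda>x. A x * g x))"
          using \<open>?L\<close> f g A by (intro pairing_right_cong Linf_times_L1 TL) auto
        then show "pairing M (\<lambda>x. A x * dual_op M T f x) g = pairing M (dual_op M T (\<lambda>x. A x * f x)) g"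
          using eqs f g by simp
      qed (intro Linf_mult V A f)+
    qed
  next
    assume ?R
    show ?L
    proof
      fix g assume g: "g \<in> L1 M"
      show "AE x in M. A x * T g x = T (\<lambda>x. A x * g x) x"
      proof (rule L1_eqI)
        fix f assume f: "f \<in> Linf M"
        have "pairing M (\<lambda>x. A x * dual_op M T f x) g = pairing M (dual_op M T (\<lambda>x. A x * f x)) g"
          using \<open>?R\<close> f g A by (intro pairing_left_cong Linf_mult V) auto
        then show "pairing M f (\<lambda>x. A x * T g x) = pairing M f (T (\<lambda>x. A x * g x))"
          using eqs f g by simp
      qed (intro Linf_times_L1 TL A g)+
    qed
  qed
qed

section \<open>Orbits of a stochastic semigroup\<close>

text \<open>Only right derivatives are available along an orbit. The function stays within slope \<open>e\<close> of
  its initial value for every \<open>e > 0\<close>: at the infimum of the points violating this the bound still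
  holds by continuity, and the right derivative extends it beyond.\<close>

lemma right_derivative_zero_imp_constant:
  fixes \<phi> :: "real \<Rightarrow> real"
  assumes cont: "continuous_on {0..} \<phi>"
    and der: "\<And>t. 0 \<le> t \<Longrightarrow> ((\<lambda>r. (\<phi> (t + r) - \<phi> t) / r) \<longlongrightarrow> 0) (at_right 0)"
    and t: "0 \<le> t"
  shows "\<phi> t = \<phi> 0"
proof -
  have slope: "\<bar>\<phi> u - \<phi> 0\<bar> \<le> e * u" if e: "0 < e" and u: "0 \<le> u" for e u
  proof (rule ccontr)
    assume bad: "\<not> \<bar>\<phi> u - \<phi> 0\<bar> \<le> e * u"
    define B where "B = {v. 0 \<le> v \<and> e * v < \<bar>\<phi> v - \<phi> 0\<bar>}"
    define s where "s = Inf B"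
    have uB: "u \<in> B" using bad u by (simp add: B_def)
    have bdd: "bdd_below B" by (rule bdd_belowI[of _ 0]) (simp add: B_def)
    have s: "0 \<le> s" unfolding s_def using uB by (intro cInf_greatest) (auto simp: B_def)
    have below: "0 \<le> e * v - \<bar>\<phi> v - \<phi> 0\<bar>" if "0 \<le> v" "v < s" for v
      using cInf_lower[OF _ bdd, of v] that by (fastforce simp: B_def s_def)
    have at_s: "0 \<le> e * s - \<bar>\<phi> s - \<phi> 0\<bar>"
    proof (cases "s = 0")
      case False
      then have "closure {0..<s} = {0..s}" using s by simp
      moreover have "continuous_on {0..s} (\<lambda>v. e * v - \<bar>\<phi> v - \<phi> 0\<bar>)"
        by (intro continuous_intros continuous_on_subset[OF cont]) auto
      ultimately show ?thesis
        using continuous_ge_on_closure[of "{0..<s}" "\<lambda>v. e * v - \<bar>\<phi> v - \<phi> 0\<bar>" s 0] below s by auto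
    qed simp
    from tendstoD[OF der[OF s] e] obtain \<delta> where \<delta>: "0 < \<delta>"
      and close: "\<And>r. 0 < r \<Longrightarrow> r < \<delta> \<Longrightarrow> \<bar>(\<phi> (s + r) - \<phi> s) / r\<bar> < e"
      by (auto simp: eventually_at_right_field dist_real_def)
    have "s + \<delta> \<le> v" if "v \<in> B" for v
    proof (rule ccontr)
      assume "\<not> s + \<delta> \<le> v"
      moreover have "s \<le> v" unfolding s_def using that bdd by (rule cInf_lower)
      moreover have "v \<noteq> s" using that at_s by (auto simp: B_def)
      ultimately have r: "0 < v - s" "v - s < \<delta>" by auto
      have "\<bar>\<phi> v - \<phi> s\<bar> < e * (v - s)"
        using close[OF r] r(1) by (simp add: field_simps)
      then have "\<bar>\<phi> v - \<phi> 0\<bar> \<le> e * v" using at_s by (simp add: algebra_simps)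
      then show False using that by (simp add: B_def)
    qed
    then have "s + \<delta> \<le> s" unfolding s_def using uB by (intro cInf_greatest) auto
    then show False using \<delta> by simp
  qed
  have "\<bar>\<phi> t - \<phi> 0\<bar> \<le> 0 + d" if "0 < d" for d
  proof -
    have "\<bar>\<phi> t - \<phi> 0\<bar> \<le> d / (t + 1) * t" using slope[of "d / (t + 1)" t] that t by simp
    also have "\<dots> \<le> d" using that t by (simp add: field_simps)
    finally show ?thesis by simp
  qed
  then have "\<bar>\<phi> t - \<phi> 0\<bar> \<le> 0" by (rule field_le_epsilon)
  then show ?thesis by simp
qed

lemma semigroup_stochastic:
  "continuous_stochastic_semigroup M U \<Longrightarrow> 0 \<le> t \<Longrightarrow> stochastic_operator M (U t)"
  by (simp add: continuous_stochastic_semigroup_def)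

lemma semigroup_L1:
  "continuous_stochastic_semigroup M U \<Longrightarrow> 0 \<le> t \<Longrightarrow> g \<in> L1 M \<Longrightarrow> U t g \<in> L1 M"
  by (rule stochastic_L1[OF semigroup_stochastic])

lemma semigroup_add:
  "continuous_stochastic_semigroup M U \<Longrightarrow> 0 \<le> s \<Longrightarrow> 0 \<le> t \<Longrightarrow> g \<in> L1 M \<Longrightarrow>
    AE x in M. U s (U t g) x = U (s + t) g x"
  by (simp add: continuous_stochastic_semigroup_def ae_eq_def)

lemma semigroup_zero:
  "continuous_stochastic_semigroup M U \<Longrightarrow> g \<in> L1 M \<Longrightarrow> AE x in M. U 0 g x = g x"
  by (simp add: continuous_stochastic_semigroup_def ae_eq_def)

lemma semigroup_continuous:
  "continuous_stochastic_semigroup M U \<Longrightarrow> g \<in> L1 M \<Longrightarrow> 0 \<le> s \<Longrightarrow>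
    ((\<lambda>t. norm_L1 M (\<lambda>x. U t g x - U s g x)) \<longlongrightarrow> 0) (at s within {0..})"
  by (simp add: continuous_stochastic_semigroup_def)

lemma pairing_semigroup_zero:
  assumes U: "continuous_stochastic_semigroup M U" and f: "f \<in> Linf M" and g: "g \<in> L1 M"
  shows "pairing M f (U 0 g) = pairing M f g"
  by (intro pairing_right_cong f g semigroup_L1[OF U] semigroup_zero[OF U]) simp

lemma pairing_semigroup_add:
  assumes U: "continuous_stochastic_semigroup M U" and f: "f \<in> Linf M" and g: "g \<in> L1 M"
    and s: "0 \<le> s" and t: "0 \<le> t"
  shows "pairing M f (U s (U t g)) = pairing M f (U (s + t) g)"
  using s t by (intro pairing_right_cong f g semigroup_L1[OF U] semigroup_add[OF U]) auto

lemma orbit_continuous_on: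
  assumes U: "continuous_stochastic_semigroup M U" and f: "f \<in> Linf M" and g: "g \<in> L1 M"
  shows "continuous_on {0..} (\<lambda>s. pairing M f (U s g))"
  unfolding continuous_on_def
proof
  fix s :: real assume s: "s \<in> {0..}"
  show "((\<lambda>s. pairing M f (U s g)) \<longlongrightarrow> pairing M f (U s g)) (at s within {0..})"
  proof (rule pairing_tendsto[where P = "\<lambda>t. 0 \<le> t", OF f])
    show "\<forall>\<^sub>F t in at s within {0..}. 0 \<le> t" by (auto simp: eventually_at_filter)
  qed (use s semigroup_L1[OF U] semigroup_continuous[OF U g] g in auto)
qed

text \<open>By the semigroup law the right derivative of \<open>t \<mapsto> \<langle>f, U t g\<rangle>\<close> at \<open>s\<close> is the one at \<open>0\<close> for
  the starting point \<open>U s g\<close>; so it suffices to know the derivative at \<open>0\<close> on an invariant set \<open>D\<close>.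
  Below, \<open>D\<close> is all of \<open>L\<^sup>1\<close> or the domain of the generator.\<close>

lemma orbit_constant:
  assumes U: "continuous_stochastic_semigroup M U" and f: "f \<in> Linf M"
    and D: "D \<subseteq> L1 M" and inv: "\<And>g t. g \<in> D \<Longrightarrow> 0 \<le> t \<Longrightarrow> U t g \<in> D"
    and der: "\<And>g. g \<in> D \<Longrightarrow> ((\<lambda>r. pairing M f (\<lambda>x. (U r g x - g x) / r)) \<longlongrightarrow> 0) (at_right 0)"
    and g: "g \<in> D" and t: "0 \<le> t"
  shows "pairing M f (U t g) = pairing M f g"
proof -
  have gL: "g \<in> L1 M" using g D by auto
  have "pairing M f (U t g) = pairing M f (U 0 g)"
  proof (rule right_derivative_zero_imp_constant[OF orbit_continuous_on[OF U f gL] _ t])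
    fix s :: real assume s: "0 \<le> s"
    have sL: "U s g \<in> L1 M" using semigroup_L1[OF U s gL] .
    have "\<forall>\<^sub>F r in at_right 0. pairing M f (\<lambda>x. (U r (U s g) x - U s g x) / r) =
        (pairing M f (U (s + r) g) - pairing M f (U s g)) / r"
      unfolding eventually_at_filter
    proof (intro always_eventually allI impI)
      fix r :: real assume "r \<in> {0<..}"
      then have r: "0 \<le> r" by simp
      have "pairing M f (\<lambda>x. (U r (U s g) x - U s g x) / r) =
          (pairing M f (U r (U s g)) - pairing M f (U s g)) / r"
        by (rule pairing_diff_quotient[OF f semigroup_L1[OF U r sL] sL])
      then show "pairing M f (\<lambda>x. (U r (U s g) x - U s g x) / r) =
          (pairing M f (U (s + r) g) - pairing M f (U s g)) / r"
        using pairing_semigroup_add[OF U f gL r s] by (simp add: add.commute)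
    qed
    then show "((\<lambda>r. (pairing M f (U (s + r) g) - pairing M f (U s g)) / r) \<longlongrightarrow> 0) (at_right 0)"
      using der[OF inv[OF g s]] by (simp add: tendsto_cong)
  qed
  then show ?thesis using pairing_semigroup_zero[OF U f gL] by simp
qed

section \<open>The generator and its domain\<close>

lemma generator_value_pairing:
  assumes U: "continuous_stochastic_semigroup M U" and f: "f \<in> Linf M" and g: "g \<in> L1 M"
    and h: "is_generator_value M U g h"
  shows "((\<lambda>r. pairing M f (\<lambda>x. (U r g x - g x) / r)) \<longlongrightarrow> pairing M f h) (at_right 0)"
proof (rule pairing_tendsto[where P = "\<lambda>r. 0 \<le> r", OF f])
  show "\<forall>\<^sub>F r :: real in at_right 0. 0 \<le> r" by (auto simp: eventually_at_filter)
qed (use h semigroup_L1[OF U _ g] g in \<open>auto simp: is_generator_value_def intro!: L1_divide L1_diff\<close>)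

lemma generator_value_unique:
  assumes U: "continuous_stochastic_semigroup M U" and g: "g \<in> L1 M"
    and h: "is_generator_value M U g h" "is_generator_value M U g h'"
  shows "AE x in M. h x = h' x"
proof (rule L1_eqI)
  fix f assume f: "f \<in> Linf M"
  show "pairing M f h = pairing M f h'"
    by (rule tendsto_unique[OF _ generator_value_pairing[OF U f g h(1)]
        generator_value_pairing[OF U f g h(2)]]) simp
qed (use h in \<open>auto simp: is_generator_value_def\<close>)

lemma generator_value: "g \<in> generator_dom M U \<Longrightarrow> is_generator_value M U g (generator M U g)"
  unfolding generator_def generator_dom_def
  by (auto intro: someI[where P = "is_generator_value M U g"])

text \<open>The semigroup preserves integrals, so every difference quotient has integral zero.\<close>

lemma generator_integral:
  assumes U: "continuous_stochastic_semigroup M U" and g: "g \<in> L1 M"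
    and h: "is_generator_value M U g h"
  shows "pairing M (\<lambda>x. 1) h = 0"
proof -
  have "\<forall>\<^sub>F r in at_right 0. pairing M (\<lambda>x. 1) (\<lambda>x. (U r g x - g x) / r) = 0"
    unfolding eventually_at_filter
  proof (intro always_eventually allI impI)
    fix r :: real assume "r \<in> {0<..}"
    then have r: "0 \<le> r" by simp
    show "pairing M (\<lambda>x. 1) (\<lambda>x. (U r g x - g x) / r) = 0"
      using pairing_diff_quotient[OF Linf_const semigroup_L1[OF U r g] g, of 1 r]
        stochastic_integral[OF semigroup_stochastic[OF U r] g]
      by simp
  qed
  then have "((\<lambda>r. pairing M (\<lambda>x. 1) (\<lambda>x. (U r g x - g x) / r)) \<longlongrightarrow> 0) (at_right 0)"
    by (rule tendsto_eventually)
  from tendsto_unique[OF _ generator_value_pairing[OF U Linf_const g h, of 1] this]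
  show ?thesis by simp
qed

lemma generator_dom_invariant:
  assumes U: "continuous_stochastic_semigroup M U" and g: "g \<in> generator_dom M U" and t: "0 \<le> t"
  shows "U t g \<in> generator_dom M U"
proof -
  have gL: "g \<in> L1 M" using g by (simp add: generator_dom_def)
  obtain h where h: "is_generator_value M U g h" using g by (auto simp: generator_dom_def)
  then have hL: "h \<in> L1 M"
    and lim: "((\<lambda>r. norm_L1 M (\<lambda>x. (U r g x - g x) / r - h x)) \<longlongrightarrow> 0) (at_right 0)"
    by (auto simp: is_generator_value_def)
  note T = semigroup_stochastic[OF U t]
  note tL = semigroup_L1[OF U t]
  have "is_generator_value M U (U t g) (U t h)"
    unfolding is_generator_value_def
  proof
    show "U t h \<in> L1 M" by (rule tL[OF hL])
    show "((\<lambda>r. norm_L1 M (\<lambda>x. (U r (U t g) x - U t g x) / r - U t h x)) \<longlongrightarrow> 0) (at_right 0)"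
    proof (rule Lim_null_comparison[OF _ lim])
      show "\<forall>\<^sub>F r in at_right 0. norm (norm_L1 M (\<lambda>x. (U r (U t g) x - U t g x) / r - U t h x))
          \<le> norm_L1 M (\<lambda>x. (U r g x - g x) / r - h x)"
        unfolding eventually_at_filter
      proof (intro always_eventually allI impI)
        fix r :: real assume "r \<in> {0<..}"
        then have r: "0 \<le> r" by simp
        note rL = semigroup_L1[OF U r]
        let ?q = "\<lambda>x. (1/r) * U r g x + (-1/r) * g x"
        have qL: "?q \<in> L1 M" by (intro L1_lin rL gL)
        have "AE x in M. U t ?q x = (1/r) * U t (U r g) x + (-1/r) * U t g x"
          by (rule stochastic_lin[OF T rL[OF gL] gL])
        moreover have "AE x in M. U t (U r g) x = U (t + r) g x"
          by (rule semigroup_add[OF U t r gL])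
        moreover have "AE x in M. U r (U t g) x = U (r + t) g x"
          by (rule semigroup_add[OF U r t gL])
        ultimately have eq: "AE x in M. (U r (U t g) x - U t g x) / r - U t h x = U t ?q x - U t h x"
          by eventually_elim (simp add: add.commute diff_divide_distrib)
        have "norm_L1 M (\<lambda>x. (U r (U t g) x - U t g x) / r - U t h x) =
            norm_L1 M (\<lambda>x. U t ?q x - U t h x)"
          by (intro norm_L1_cong eq L1_diff L1_divide rL tL gL hL qL)
        also have "\<dots> \<le> norm_L1 M (\<lambda>x. ?q x - h x)"
          by (rule stochastic_norm_diff[OF T qL hL])
        finally show "norm (norm_L1 M (\<lambda>x. (U r (U t g) x - U t g x) / r - U t h x))
          \<le> norm_L1 M (\<lambda>x. (U r g x - g x) / r - h x)"
          by (simp add: norm_L1_nonneg diff_divide_distrib)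
      qed
    qed
  qed
  then show ?thesis using tL[OF gL] by (auto simp: generator_dom_def)
qed

lemma orbit_integrable:
  assumes "continuous_stochastic_semigroup M U" "f \<in> Linf M" "g \<in> L1 M" "0 \<le> a"
  shows "(\<lambda>s. pairing M f (U s g)) integrable_on {a..b}"
  using assms
  by (intro integrable_continuous_real continuous_on_subset[OF orbit_continuous_on]) auto

text \<open>Nonnegativity of \<open>g\<close> makes \<open>f \<mapsto> \<integral> \<langle>f, U s g\<rangle> ds\<close> a positive functional of \<open>f\<close>.\<close>

lemma orbit_integral_nonneg_exists:
  assumes M: "sigma_finite_measure M" and U: "continuous_stochastic_semigroup M U"
    and g: "g \<in> L1 M" "AE x in M. 0 \<le> g x"
  shows "\<exists>G\<in>L1 M. \<forall>f\<in>Linf M. integral {0..\<epsilon>} (\<lambda>s. pairing M f (U s g)) = pairing M f G"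
proof (rule normal_functional_representation[OF M])
  note sL = semigroup_L1[OF U _ g(1)] and int = orbit_integrable[OF U _ g(1) order.refl]
  fix k l :: "'a \<Rightarrow> real" and a b :: real
  assume kl: "k \<in> Linf M" "l \<in> Linf M"
  have "integral {0..\<epsilon>} (\<lambda>s. pairing M (\<lambda>x. a * k x + b * l x) (U s g)) =
      integral {0..\<epsilon>} (\<lambda>s. a * pairing M k (U s g) + b * pairing M l (U s g))"
    by (intro Henstock_Kurzweil_Integration.integral_cong pairing_left_lin kl sL) auto
  also have "\<dots> = a * integral {0..\<epsilon>} (\<lambda>s. pairing M k (U s g)) +
      b * integral {0..\<epsilon>} (\<lambda>s. pairing M l (U s g))"
    using int[OF kl(1)] int[OF kl(2)]
    by (subst Henstock_Kurzweil_Integration.integral_add) (auto intro: integrable_on_mult_right)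
  finally show "integral {0..\<epsilon>} (\<lambda>s. pairing M (\<lambda>x. a * k x + b * l x) (U s g)) = \<dots>" .
next
  fix k :: "'a \<Rightarrow> real" assume k: "k \<in> Linf M" "AE x in M. 0 \<le> k x"
  show "0 \<le> integral {0..\<epsilon>} (\<lambda>s. pairing M k (U s g))"
    using stochastic_nonneg(1)[OF semigroup_stochastic[OF U] g]
    by (intro Henstock_Kurzweil_Integration.integral_nonneg orbit_integrable[OF U k(1) g(1)]
        pairing_nonneg k(2)) auto
next
  fix K :: "nat \<Rightarrow> 'a \<Rightarrow> real" and k B
  assume K: "\<And>n. K n \<in> Linf M" "k \<in> Linf M" and b: "\<And>n x. x \<in> space M \<Longrightarrow> \<bar>K n x\<bar> \<le> B"
    and lim: "\<And>x. x \<in> space M \<Longrightarrow> (\<lambda>n. K n x) \<longlonglongrightarrow> k x"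
  have b': "AE x in M. \<bar>K n x\<bar> \<le> \<bar>B\<bar>" for n
    using b[of _ n] by (intro AE_I2) (meson abs_ge_self order_trans)
  show "(\<lambda>n. integral {0..\<epsilon>} (\<lambda>s. pairing M (K n) (U s g))) \<longlonglongrightarrow> integral {0..\<epsilon>} (\<lambda>s. pairing M k (U s g))"
  proof (rule dominated_convergence(2)[where h = "\<lambda>_. \<bar>B\<bar> * norm_L1 M g"])
    fix n s assume "s \<in> {0..\<epsilon>}"
    then have s: "0 \<le> s" by simp
    have "\<bar>pairing M (K n) (U s g)\<bar> \<le> \<bar>B\<bar> * norm_L1 M (U s g)"
      by (rule pairing_bound[OF Linf_measurable[OF K(1)] b' semigroup_L1[OF U s g(1)]])
    then show "norm (pairing M (K n) (U s g)) \<le> \<bar>B\<bar> * norm_L1 M g"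
      using stochastic_nonneg(2)[OF semigroup_stochastic[OF U s] g] by simp
  next
    fix s assume "s \<in> {0..\<epsilon>}"
    then have sL: "U s g \<in> L1 M" using semigroup_L1[OF U _ g(1)] by simp
    have KL: "(\<lambda>x. K n x * U s g x) \<in> L1 M" "(\<lambda>x. k x * U s g x) \<in> L1 M" for n
      using K sL by (auto intro: Linf_times_L1)
    show "(\<lambda>n. pairing M (K n) (U s g)) \<longlonglongrightarrow> pairing M k (U s g)"
      unfolding pairing_def
    proof (rule integral_dominated_convergence[where w = "\<lambda>x. \<bar>B\<bar> * \<bar>U s g x\<bar>"])
      show "AE x in M. (\<lambda>n. K n x * U s g x) \<longlonglongrightarrow> k x * U s g x"
        using lim by (intro AE_I2 tendsto_mult) auto
      show "AE x in M. norm (K n x * U s g x) \<le> \<bar>B\<bar> * \<bar>U s g x\<bar>" for n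
        using b'[of n] by eventually_elim (auto simp: abs_mult intro!: mult_right_mono)
    qed (use KL sL in \<open>auto simp: L1_def\<close>)
  qed (use orbit_integrable[OF U K(1) g(1)] in \<open>auto intro: integrable_const_ivl\<close>)
qed

text \<open>The element \<open>G\<close> is the weak integral of \<open>s \<mapsto> U s g\<close> over \<open>[0, \<epsilon>]\<close>.\<close>

lemma orbit_integral_exists:
  assumes M: "sigma_finite_measure M" and U: "continuous_stochastic_semigroup M U" and g: "g \<in> L1 M"
  obtains G where "G \<in> L1 M"
    "\<And>f. f \<in> Linf M \<Longrightarrow> pairing M f G = integral {0..\<epsilon>} (\<lambda>s. pairing M f (U s g))"
proof -
  let ?p = "\<lambda>x. max 0 (g x)" and ?n = "\<lambda>x. max 0 (- g x)"
  note L = L1_pos_neg[OF g]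
  obtain P where P: "P \<in> L1 M"
    "\<And>f. f \<in> Linf M \<Longrightarrow> integral {0..\<epsilon>} (\<lambda>s. pairing M f (U s ?p)) = pairing M f P"
    using orbit_integral_nonneg_exists[OF M U L(1)] by fastforce
  obtain N where N: "N \<in> L1 M"
    "\<And>f. f \<in> Linf M \<Longrightarrow> integral {0..\<epsilon>} (\<lambda>s. pairing M f (U s ?n)) = pairing M f N"
    using orbit_integral_nonneg_exists[OF M U L(2)] by fastforce
  show thesis
  proof (rule that[of "\<lambda>x. P x - N x"])
    show "(\<lambda>x. P x - N x) \<in> L1 M" by (intro L1_diff P N)
    fix f assume f: "f \<in> Linf M"
    have g_eq: "g = (\<lambda>x. 1 * ?p x + (-1) * ?n x)" by auto
    have eq: "pairing M f (U s g) = pairing M f (U s ?p) - pairing M f (U s ?n)" if "s \<in> {0..\<epsilon>}" for s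
      using pairing_stochastic_lin[OF semigroup_stochastic[OF U] f L, of s 1 "-1"] that
      by (subst g_eq) simp
    have "pairing M f (\<lambda>x. P x - N x) = pairing M f P - pairing M f N"
      by (rule pairing_right_diff[OF f P(1) N(1)])
    also have "\<dots> = integral {0..\<epsilon>} (\<lambda>s. pairing M f (U s ?p) - pairing M f (U s ?n))"
      unfolding P(2)[OF f, symmetric] N(2)[OF f, symmetric]
      by (intro Henstock_Kurzweil_Integration.integral_diff[symmetric] orbit_integrable[OF U f] L) auto
    also have "\<dots> = integral {0..\<epsilon>} (\<lambda>s. pairing M f (U s g))"
      by (rule Henstock_Kurzweil_Integration.integral_cong) (simp add: eq)
    finally show "pairing M f (\<lambda>x. P x - N x) = integral {0..\<epsilon>} (\<lambda>s. pairing M f (U s g))" .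
  qed
qed

text \<open>Formally, \<open>U r G - G\<close> is the integral of the orbit over \<open>[\<epsilon>, \<epsilon> + r]\<close> minus that over
  \<open>[0, r]\<close>, so the generator maps \<open>G\<close> to \<open>U \<epsilon> g - g\<close>. Since \<open>G\<close> is only known through its pairings,
  convergence in norm is obtained by pairing with the sign of the error, where the orbit deviates
  from its values at \<open>\<epsilon>\<close> and at \<open>0\<close> by an amount that does not depend on that sign.\<close>

lemma orbit_integral_in_generator_dom:
  assumes M: "sigma_finite_measure M" and U: "continuous_stochastic_semigroup M U" and g: "g \<in> L1 M"
    and \<epsilon>: "0 \<le> \<epsilon>" and G: "G \<in> L1 M"
    and G_eq: "\<And>f. f \<in> Linf M \<Longrightarrow> pairing M f G = integral {0..\<epsilon>} (\<lambda>s. pairing M f (U s g))"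
  shows "G \<in> generator_dom M U"
proof -
  note sL = semigroup_L1[OF U _ g]
  have shift: "pairing M f (U r G) = integral {r..\<epsilon>+r} (\<lambda>s. pairing M f (U s g))"
    if f: "f \<in> Linf M" and r: "0 \<le> r" for f r
  proof -
    note T = semigroup_stochastic[OF U r]
    have "pairing M f (U r G) = integral {0..\<epsilon>} (\<lambda>s. pairing M (dual_op M (U r) f) (U s g))"
      using dual_op_pairing[OF M T f G] G_eq[OF dual_op_Linf[OF M T f]] by simp
    also have "\<dots> = integral {0..\<epsilon>} ((\<lambda>s. pairing M f (U s g)) \<circ> (+) r)"
    proof (rule Henstock_Kurzweil_Integration.integral_cong)
      fix s assume "s \<in> {0..\<epsilon>}"
      then have s: "0 \<le> s" by simp
      show "pairing M (dual_op M (U r) f) (U s g) = ((\<lambda>s. pairing M f (U s g)) \<circ> (+) r) s"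
        using dual_op_pairing[OF M T f sL[OF s]] pairing_semigroup_add[OF U f g r s] by simp
    qed
    also have "\<dots> = integral {r..\<epsilon>+r} (\<lambda>s. pairing M f (U s g))"
      by (simp add: integral_shift_Icc_real)
    finally show ?thesis .
  qed
  let ?D = "\<lambda>r x. (U r G x - G x) / r - (U \<epsilon> g x - g x)"
  have modulus: "\<exists>\<delta>>0. \<forall>t\<ge>s. t < s + \<delta> \<longrightarrow> norm_L1 M (\<lambda>x. U t g x - U s g x) \<le> \<eta>"
    if s: "0 \<le> s" and \<eta>: "0 < \<eta>" for s \<eta>
  proof -
    obtain \<delta> where \<delta>: "0 < \<delta>" "\<And>t. 0 \<le> t \<Longrightarrow> t \<noteq> s \<Longrightarrow> \<bar>t - s\<bar> < \<delta> \<Longrightarrow>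
        norm_L1 M (\<lambda>x. U t g x - U s g x) < \<eta>"
      using tendstoD[OF semigroup_continuous[OF U g s] \<eta>]
      by (fastforce simp: eventually_at dist_real_def abs_of_nonneg[OF norm_L1_nonneg])
    have "norm_L1 M (\<lambda>x. U t g x - U s g x) \<le> \<eta>" if "s \<le> t" "t < s + \<delta>" for t
    proof (cases "t = s")
      case True
      then show ?thesis using \<eta> by (simp add: norm_L1_def)
    next
      case False
      then show ?thesis using \<delta>(2)[of t] that s by simp
    qed
    then show ?thesis using \<delta>(1) by blast
  qed
  have small: "\<forall>\<^sub>F r in at_right 0. norm_L1 M (?D r) < \<eta>" if \<eta>: "0 < \<eta>" for \<eta>
  proof -
    define \<beta> where "\<beta> = \<eta> / 3"
    have \<beta>: "0 < \<beta>" using \<eta> by (simp add: \<beta>_def)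
    obtain \<delta>1 where \<delta>1: "0 < \<delta>1" "\<And>t. \<epsilon> \<le> t \<Longrightarrow> t < \<epsilon> + \<delta>1 \<Longrightarrow> norm_L1 M (\<lambda>x. U t g x - U \<epsilon> g x) \<le> \<beta>"
      using modulus[OF \<epsilon> \<beta>] by blast
    obtain \<delta>2 where \<delta>2: "0 < \<delta>2" "\<And>t. 0 \<le> t \<Longrightarrow> t < 0 + \<delta>2 \<Longrightarrow> norm_L1 M (\<lambda>x. U t g x - U 0 g x) \<le> \<beta>"
      using modulus[OF order.refl \<beta>] by blast
    have "norm_L1 M (?D r) < \<eta>" if r: "0 < r" "r < min \<delta>1 \<delta>2" for r
    proof -
      have rL: "U r G \<in> L1 M" using semigroup_L1[OF U _ G] r by simp
      have D: "?D r \<in> L1 M" by (intro L1_diff L1_divide rL G sL g \<epsilon>)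
      define f where "f = (\<lambda>x. sgn (?D r x))"
      have f: "f \<in> Linf M" and f_norm: "pairing M f (?D r) = norm_L1 M (?D r)"
        unfolding f_def by (rule norm_L1_eq_pairing_sgn[OF D])+
      have f_le: "AE x in M. \<bar>f x\<bar> \<le> 1" by (simp add: f_def sgn_real_def)
      define m where "m = (\<lambda>s. pairing M f (U s g))"
      have m_int: "m integrable_on {a..b}" if "0 \<le> a" for a b
        unfolding m_def by (rule orbit_integrable[OF U f g that])
      have m_bound: "\<bar>integral {a..a+r} m - r * m a\<bar> \<le> \<beta> * r"
        if a: "0 \<le> a" and le: "\<And>t. a \<le> t \<Longrightarrow> t \<le> a + r \<Longrightarrow> norm_L1 M (\<lambda>x. U t g x - U a g x) \<le> \<beta>" for a
      proof -
        have "norm (integral {a..a+r} (\<lambda>s. m s - m a)) \<le> \<beta> * (a + r - a)"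
        proof (rule integral_bound)
          show "continuous_on {a..a+r} (\<lambda>s. m s - m a)"
            unfolding m_def using a
            by (intro continuous_intros continuous_on_subset[OF orbit_continuous_on[OF U f g]]) auto
          fix t assume t: "t \<in> {a..a+r}"
          then have tL: "U t g \<in> L1 M" using sL a by simp
          have "\<bar>pairing M f (\<lambda>x. U t g x - U a g x)\<bar> \<le> 1 * norm_L1 M (\<lambda>x. U t g x - U a g x)"
            by (intro pairing_bound Linf_measurable[OF f] f_le L1_diff tL sL a)
          then show "norm (m t - m a) \<le> \<beta>"
            using le[of t] t pairing_right_diff[OF f tL sL[OF a]] by (simp add: m_def)
        qed (use r in simp)
        moreover have "integral {a..a+r} (\<lambda>s. m s - m a) = integral {a..a+r} m - r * m a"
          using r by (subst Henstock_Kurzweil_Integration.integral_diff) (auto intro: m_int[OF a])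
        ultimately show ?thesis by simp
      qed
      have "integral {0..r} m + integral {r..\<epsilon>+r} m = integral {0..\<epsilon>+r} m"
        using r \<epsilon> by (intro Henstock_Kurzweil_Integration.integral_combine m_int) auto
      moreover have "integral {0..\<epsilon>} m + integral {\<epsilon>..\<epsilon>+r} m = integral {0..\<epsilon>+r} m"
        using r \<epsilon> by (intro Henstock_Kurzweil_Integration.integral_combine m_int) auto
      ultimately have split: "integral {r..\<epsilon>+r} m - integral {0..\<epsilon>} m = integral {\<epsilon>..\<epsilon>+r} m - integral {0..0+r} m"
        by simp
      have quot: "pairing M f (\<lambda>x. (U r G x - G x) / r) = (pairing M f (U r G) - pairing M f G) / r"
        by (rule pairing_diff_quotient[OF f rL G])
      have "norm_L1 M (?D r) = (pairing M f (U r G) - pairing M f G) / r - (m \<epsilon> - m 0)"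
        unfolding f_norm[symmetric] quot[symmetric] m_def pairing_semigroup_zero[OF U f g]
          pairing_right_diff[OF f sL[OF \<epsilon>] g, symmetric]
        by (intro pairing_right_diff f L1_diff L1_divide rL G sL g \<epsilon>)
      also have "\<dots> = (integral {r..\<epsilon>+r} m - integral {0..\<epsilon>} m) / r - (m \<epsilon> - m 0)"
        using shift[OF f, of r] G_eq[OF f] r by (simp add: m_def)
      also have "\<dots> = ((integral {\<epsilon>..\<epsilon>+r} m - r * m \<epsilon>) - (integral {0..0+r} m - r * m 0)) / r"
        unfolding split using r by (simp add: field_simps)
      also have "\<dots> \<le> (\<beta> * r + \<beta> * r) / r"
      proof (rule divide_right_mono)
        have "\<bar>integral {\<epsilon>..\<epsilon>+r} m - r * m \<epsilon>\<bar> \<le> \<beta> * r"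
          using r by (intro m_bound \<epsilon> \<delta>1) auto
        moreover have "\<bar>integral {0..0+r} m - r * m 0\<bar> \<le> \<beta> * r"
          using r by (intro m_bound \<delta>2) auto
        ultimately show "(integral {\<epsilon>..\<epsilon>+r} m - r * m \<epsilon>) - (integral {0..0+r} m - r * m 0) \<le> \<beta> * r + \<beta> * r"
          by linarith
      qed (use r in simp)
      also have "\<dots> < \<eta>" using r \<eta> by (simp add: \<beta>_def field_simps)
      finally show ?thesis .
    qed
    then show ?thesis
      using \<delta>1(1) \<delta>2(1) unfolding eventually_at_right_field by (intro exI[of _ "min \<delta>1 \<delta>2"]) auto
  qed
  have "is_generator_value M U G (\<lambda>x. U \<epsilon> g x - g x)"
    unfolding is_generator_value_def
  proof
    show "((\<lambda>r. norm_L1 M (?D r)) \<longlongrightarrow> 0) (at_right 0)"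
      using small by (intro tendstoI) (simp add: norm_L1_nonneg)
  qed (intro L1_diff sL g \<epsilon>)
  then show ?thesis using G by (auto simp: generator_dom_def)
qed

section \<open>Conserved observables\<close>

text \<open>Conservation is the common form of the conditions on \<open>A\<close> and \<open>A\<^sup>2\<close>: each of those on expected
  values, on fixed points of the dual and on the kernel of its generator is equivalent to it,
  separately for every bounded \<open>f\<close>.\<close>

definition conserved ::
    "'a measure \<Rightarrow> (real \<Rightarrow> ('a \<Rightarrow> real) \<Rightarrow> ('a \<Rightarrow> real)) \<Rightarrow> ('a \<Rightarrow> real) \<Rightarrow> bool" where
  "conserved M U f \<longleftrightarrow> (\<forall>t\<ge>0. \<forall>g\<in>L1 M. pairing M f (U t g) = pairing M f g)"

text \<open>This takes the place of density of the domain. The weak orbit integrals lie in the domain, so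
  the difference \<open>\<langle>f, U t (U s g)\<rangle> - \<langle>f, U s g\<rangle>\<close> integrates to zero over every \<open>[0, \<epsilon>]\<close>; being
  continuous in \<open>s\<close> it vanishes at \<open>s = 0\<close>. The dual operator is used to write both terms as
  pairings with the orbit of \<open>g\<close>.\<close>

lemma conserved_if_conserved_on_generator_dom:
  assumes M: "sigma_finite_measure M" and U: "continuous_stochastic_semigroup M U" and f: "f \<in> Linf M"
    and dom: "\<And>g t. g \<in> generator_dom M U \<Longrightarrow> 0 \<le> t \<Longrightarrow> pairing M f (U t g) = pairing M f g"
  shows "conserved M U f"
  unfolding conserved_def
proof (intro allI impI ballI)
  fix t :: real and g assume t: "0 \<le> t" and g: "g \<in> L1 M"
  note T = semigroup_stochastic[OF U t]
  define V where "V = dual_op M (U t) f"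
  have V: "V \<in> Linf M" unfolding V_def by (rule dual_op_Linf[OF M T f])
  define \<psi> where "\<psi> = (\<lambda>s. pairing M V (U s g) - pairing M f (U s g))"
  have zero: "integral {0..\<epsilon>} \<psi> = 0" if \<epsilon>: "0 \<le> \<epsilon>" for \<epsilon>
  proof -
    obtain G where G: "G \<in> L1 M"
      "\<And>k. k \<in> Linf M \<Longrightarrow> pairing M k G = integral {0..\<epsilon>} (\<lambda>s. pairing M k (U s g))"
      using orbit_integral_exists[OF M U g] by blast
    have "integral {0..\<epsilon>} \<psi> = pairing M V G - pairing M f G"
      unfolding \<psi>_def G(2)[OF V] G(2)[OF f]
      by (intro Henstock_Kurzweil_Integration.integral_diff orbit_integrable[OF U] V f g) auto
    also have "\<dots> = pairing M f (U t G) - pairing M f G"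
      using dual_op_pairing[OF M T f G(1)] by (simp add: V_def)
    also have "\<dots> = 0"
      using dom[OF orbit_integral_in_generator_dom[OF M U g \<epsilon> G] t] by simp
    finally show ?thesis .
  qed
  have cont: "continuous_on {0..1} \<psi>"
    unfolding \<psi>_def
    by (intro continuous_intros continuous_on_subset[OF orbit_continuous_on[OF U]] V f g) auto
  have "((\<lambda>\<epsilon>. integral {0..\<epsilon>} \<psi>) has_vector_derivative \<psi> 0) (at 0 within {0..1})"
    by (rule integral_has_vector_derivative[OF cont]) simp
  moreover have "((\<lambda>\<epsilon>. integral {0..\<epsilon>} \<psi>) has_vector_derivative 0) (at 0 within {0..1})"
    by (rule has_vector_derivative_transform[where f = "\<lambda>_. 0"]) (auto simp: zero)
  ultimately have "\<psi> 0 = 0"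
    using vector_derivative_unique_within_closed_interval[of 0 1 0] by simp
  then show "pairing M f (U t g) = pairing M f g"
    using dual_op_pairing[OF M T f g] pairing_semigroup_zero[OF U V g] pairing_semigroup_zero[OF U f g]
    by (simp add: \<psi>_def V_def)
qed

lemma conserved_iff_dual_op_fixed:
  assumes M: "sigma_finite_measure M" and U: "continuous_stochastic_semigroup M U" and f: "f \<in> Linf M"
  shows "conserved M U f \<longleftrightarrow> (\<forall>t\<ge>0. AE x in M. dual_op M (U t) f x = f x)"
proof
  assume c: "conserved M U f"
  show "\<forall>t\<ge>0. AE x in M. dual_op M (U t) f x = f x"
    using c by (auto simp: conserved_def intro!: dual_op_eqI[OF M semigroup_stochastic[OF U] f f])
next
  assume fix_f: "\<forall>t\<ge>0. AE x in M. dual_op M (U t) f x = f x"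
  show "conserved M U f"
    unfolding conserved_def
  proof (intro allI impI ballI)
    fix t :: real and g assume t: "0 \<le> t" and g: "g \<in> L1 M"
    note T = semigroup_stochastic[OF U t]
    show "pairing M f (U t g) = pairing M f g"
      unfolding dual_op_pairing[OF M T f g]
      using fix_f t by (intro pairing_left_cong dual_op_Linf[OF M T] f g) auto
  qed
qed

lemma conserved_iff_expectation_constant:
  assumes M: "sigma_finite_measure M" and U: "continuous_stochastic_semigroup M U" and f: "f \<in> Linf M"
  shows "conserved M U f \<longleftrightarrow>
    (\<forall>g. prob_distribution M g \<longrightarrow> (\<lambda>t. pairing M f (U t g)) constant_on {0..})"
proof
  assume "conserved M U f"
  then show "\<forall>g. prob_distribution M g \<longrightarrow> (\<lambda>t. pairing M f (U t g)) constant_on {0..}"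
    by (auto simp: conserved_def constant_on_def prob_distribution_def)
next
  assume const: "\<forall>g. prob_distribution M g \<longrightarrow> (\<lambda>t. pairing M f (U t g)) constant_on {0..}"
  show "conserved M U f"
    unfolding conserved_def
  proof (intro allI impI ballI)
    fix t :: real and g assume t: "0 \<le> t" and g: "g \<in> L1 M"
    note T = semigroup_stochastic[OF U t]
    note V = dual_op_Linf[OF M T f]
    have "pairing M (dual_op M (U t) f) g = pairing M f g"
    proof (rule pairing_eq_if_eq_on_nonneg[OF V f g])
      fix h assume h: "h \<in> L1 M" "AE x in M. 0 \<le> h x"
      define n where "n = norm_L1 M h"
      show "pairing M (dual_op M (U t) f) h = pairing M f h"
      proof (cases "n = 0")
        case True
        have "pairing M k h = 0" if "k \<in> Linf M" for k
          using Linf_bound[OF that] pairing_bound[OF Linf_measurable[OF that] _ h(1)] True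
          by (metis abs_le_zero_iff mult_zero_right n_def)
        then show ?thesis using V f by simp
      next
        case False
        then have n: "0 < n" using norm_L1_nonneg[of M h] by (simp add: n_def)
        let ?p = "\<lambda>x. inverse n * h x"
        have pL: "?p \<in> L1 M" by (rule L1_scale[OF h(1)])
        have "prob_distribution M ?p"
          using prob_distribution_normalize[OF h] n by (simp add: n_def)
        then have "(\<lambda>t. pairing M f (U t ?p)) constant_on {0..}" using const by blast
        then have "pairing M f (U t ?p) = pairing M f (U 0 ?p)"
          using t by (auto simp: constant_on_def)
        then have "pairing M (dual_op M (U t) f) ?p = pairing M f ?p"
          using dual_op_pairing[OF M T f pL] pairing_semigroup_zero[OF U f pL] by simp
        moreover have "pairing M k ?p = inverse n * pairing M k h" for k
          by (simp add: pairing_def mult.left_commute)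
        ultimately show ?thesis using n by simp
      qed
    qed
    then show "pairing M f (U t g) = pairing M f g" using dual_op_pairing[OF M T f g] by simp
  qed
qed

text \<open>The weak difference quotients of the dual semigroup at \<open>f\<close> are the difference quotients of
  the orbits paired with \<open>f\<close>, so a vanishing weak derivative at \<open>0\<close> makes all
  \<open>t \<mapsto> \<langle>f, U t g\<rangle>\<close> constant.\<close>

lemma conserved_iff_wstar_generator_zero:
  assumes M: "sigma_finite_measure M" and U: "continuous_stochastic_semigroup M U" and f: "f \<in> Linf M"
  shows "conserved M U f \<longleftrightarrow> f \<in> wstar_generator_dom M (\<lambda>t. dual_op M (U t)) \<and>
    (AE x in M. wstar_generator M (\<lambda>t. dual_op M (U t)) f x = 0)"
proof -
  let ?V = "\<lambda>t. dual_op M (U t)"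
  have quot: "\<forall>\<^sub>F r in at_right 0. pairing M (\<lambda>x. (?V r f x - f x) / r) g =
      pairing M f (\<lambda>x. (U r g x - g x) / r)" if g: "g \<in> L1 M" for g
    unfolding eventually_at_filter
  proof (intro always_eventually allI impI)
    fix r :: real assume "r \<in> {0<..}"
    then have r: "0 \<le> r" by simp
    note T = semigroup_stochastic[OF U r]
    show "pairing M (\<lambda>x. (?V r f x - f x) / r) g = pairing M f (\<lambda>x. (U r g x - g x) / r)"
      using pairing_left_lin[OF dual_op_Linf[OF M T f] f g, of "1/r" "-1/r"]
        pairing_diff_quotient[OF f stochastic_L1[OF T g] g] dual_op_pairing[OF M T f g]
      by (simp add: diff_divide_distrib)
  qed
  have weak: "is_wstar_generator_value M ?V f h \<longleftrightarrow> h \<in> Linf M \<and>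
      (\<forall>g\<in>L1 M. ((\<lambda>r. pairing M f (\<lambda>x. (U r g x - g x) / r)) \<longlongrightarrow> pairing M h g) (at_right 0))" for h
    unfolding is_wstar_generator_value_def using tendsto_cong[OF quot] by auto
  show ?thesis
  proof
    assume c: "conserved M U f"
    have "((\<lambda>r. pairing M f (\<lambda>x. (U r g x - g x) / r)) \<longlongrightarrow> 0) (at_right 0)" if g: "g \<in> L1 M" for g
    proof (rule tendsto_eventually, unfold eventually_at_filter, intro always_eventually allI impI)
      fix r :: real assume "r \<in> {0<..}"
      then have r: "0 \<le> r" by simp
      then have "pairing M f (U r g) = pairing M f g" using c g by (simp add: conserved_def)
      then show "pairing M f (\<lambda>x. (U r g x - g x) / r) = 0"
        using pairing_diff_quotient[OF f semigroup_L1[OF U r g] g] by simp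
    qed
    then have z: "is_wstar_generator_value M ?V f (\<lambda>x. 0)"
      unfolding weak by (simp add: Linf_const) (simp add: pairing_def)
    then have w: "is_wstar_generator_value M ?V f (wstar_generator M ?V f)"
      unfolding wstar_generator_def
      by (rule someI[where P = "is_wstar_generator_value M ?V f"])
    have "AE x in M. wstar_generator M ?V f x = 0"
    proof (rule Linf_eqI[OF M _ Linf_const])
      show "wstar_generator M ?V f \<in> Linf M" using w by (simp add: weak)
      fix g assume g: "g \<in> L1 M"
      show "pairing M (wstar_generator M ?V f) g = pairing M (\<lambda>x. 0) g"
        using w z g unfolding weak by (blast intro: tendsto_unique[OF trivial_limit_at_right_real])
    qed
    then show "f \<in> wstar_generator_dom M ?V \<and> (AE x in M. wstar_generator M ?V f x = 0)"
      using z f by (auto simp: wstar_generator_dom_def)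
  next
    assume a: "f \<in> wstar_generator_dom M ?V \<and> (AE x in M. wstar_generator M ?V f x = 0)"
    then obtain h where "is_wstar_generator_value M ?V f h" by (auto simp: wstar_generator_dom_def)
    then have w: "is_wstar_generator_value M ?V f (wstar_generator M ?V f)"
      unfolding wstar_generator_def
      by (rule someI[where P = "is_wstar_generator_value M ?V f"])
    have der: "((\<lambda>r. pairing M f (\<lambda>x. (U r g x - g x) / r)) \<longlongrightarrow> 0) (at_right 0)" if g: "g \<in> L1 M" for g
    proof -
      have "pairing M (wstar_generator M ?V f) g = pairing M (\<lambda>x. 0) g"
        using a w g by (intro pairing_left_cong Linf_const) (auto simp: weak)
      then have "pairing M (wstar_generator M ?V f) g = 0" by (simp add: pairing_def)
      then show ?thesis using w g by (auto simp: weak)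
    qed
    show "conserved M U f"
      unfolding conserved_def
      by (intro allI impI ballI orbit_constant[OF U f order.refl _ der] semigroup_L1[OF U])
  qed
qed

section \<open>Commutation with the semigroup\<close>

lemma generator_value_mult:
  assumes U: "continuous_stochastic_semigroup M U" and A: "A \<in> Linf M" and g: "g \<in> L1 M"
    and comm: "\<And>t. 0 \<le> t \<Longrightarrow> AE x in M. A x * U t g x = U t (\<lambda>x. A x * g x) x"
    and h: "is_generator_value M U g h"
  shows "is_generator_value M U (\<lambda>x. A x * g x) (\<lambda>x. A x * h x)"
  unfolding is_generator_value_def
proof
  have hL: "h \<in> L1 M"
    and lim: "((\<lambda>r. norm_L1 M (\<lambda>x. (U r g x - g x) / r - h x)) \<longlongrightarrow> 0) (at_right 0)"
    using h by (auto simp: is_generator_value_def)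
  show "(\<lambda>x. A x * h x) \<in> L1 M" by (rule Linf_times_L1[OF A hL])
  obtain C where C: "0 \<le> C" "AE x in M. \<bar>A x\<bar> \<le> C" using Linf_bound[OF A] by blast
  show "((\<lambda>r. norm_L1 M (\<lambda>x. (U r (\<lambda>x. A x * g x) x - A x * g x) / r - A x * h x)) \<longlongrightarrow> 0) (at_right 0)"
  proof (rule Lim_null_comparison)
    show "((\<lambda>r. C * norm_L1 M (\<lambda>x. (U r g x - g x) / r - h x)) \<longlongrightarrow> 0) (at_right 0)"
      by (rule tendsto_mult_right_zero[OF lim])
    show "\<forall>\<^sub>F r in at_right 0. norm (norm_L1 M (\<lambda>x. (U r (\<lambda>x. A x * g x) x - A x * g x) / r - A x * h x))
        \<le> C * norm_L1 M (\<lambda>x. (U r g x - g x) / r - h x)"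
      unfolding eventually_at_filter
    proof (intro always_eventually allI impI)
      fix r :: real assume "r \<in> {0<..}"
      then have r: "0 \<le> r" by simp
      note rL = semigroup_L1[OF U r]
      have "norm_L1 M (\<lambda>x. (U r (\<lambda>x. A x * g x) x - A x * g x) / r - A x * h x) \<le>
          norm_L1 M (\<lambda>x. C * ((U r g x - g x) / r - h x))"
      proof (rule norm_L1_mono)
        show "AE x in M. \<bar>(U r (\<lambda>x. A x * g x) x - A x * g x) / r - A x * h x\<bar>
            \<le> \<bar>C * ((U r g x - g x) / r - h x)\<bar>"
          using comm[OF r] C(2)
        proof eventually_elim
          case (elim x)
          have "(U r (\<lambda>x. A x * g x) x - A x * g x) / r - A x * h x = A x * ((U r g x - g x) / r - h x)"
            unfolding elim(1)[symmetric] by (simp add: diff_divide_distrib right_diff_distrib)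
          then show ?case using elim(2) C(1) by (simp add: abs_mult mult_right_mono)
        qed
      qed (intro L1_diff L1_divide L1_scale rL Linf_times_L1 A g hL)+
      then show "norm (norm_L1 M (\<lambda>x. (U r (\<lambda>x. A x * g x) x - A x * g x) / r - A x * h x))
        \<le> C * norm_L1 M (\<lambda>x. (U r g x - g x) / r - h x)"
        using C(1) by (simp only: norm_L1_scale) (simp add: norm_L1_nonneg)
    qed
  qed
qed

lemma conserved_if_generator_integral_zero:
  assumes M: "sigma_finite_measure M" and U: "continuous_stochastic_semigroup M U" and f: "f \<in> Linf M"
    and zero: "\<And>g. g \<in> generator_dom M U \<Longrightarrow> pairing M f (generator M U g) = 0"
  shows "conserved M U f"
proof (rule conserved_if_conserved_on_generator_dom[OF M U f])
  have DL: "generator_dom M U \<subseteq> L1 M" by (auto simp: generator_dom_def)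
  fix g and t :: real assume g: "g \<in> generator_dom M U" and t: "0 \<le> t"
  show "pairing M f (U t g) = pairing M f g"
  proof (rule orbit_constant[OF U f DL generator_dom_invariant[OF U] _ g t])
    fix k assume k: "k \<in> generator_dom M U"
    then show "((\<lambda>r. pairing M f (\<lambda>x. (U r k x - k x) / r)) \<longlongrightarrow> 0) (at_right 0)"
      using generator_value_pairing[OF U f _ generator_value[OF k]] zero[OF k] DL by auto
  qed
qed

theorem theorem4p2:
  fixes M :: "'a measure"
    and U :: "real \<Rightarrow> ('a \<Rightarrow> real) \<Rightarrow> ('a \<Rightarrow> real)"
    and A :: "'a \<Rightarrow> real"
  assumes "sigma_finite_measure M"
    and "continuous_stochastic_semigroup M U"
    and "A \<in> Linf M"
  defines "H \<equiv> generator M U"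
    and "Us \<equiv> (\<lambda>t. dual_op M (U t))"
    and "Hs \<equiv> wstar_generator M (\<lambda>t. dual_op M (U t))"
    and "DomH \<equiv> generator_dom M U"
    and "DomHs \<equiv> wstar_generator_dom M (\<lambda>t. dual_op M (U t))"
    and "A2 \<equiv> (\<lambda>x. (A x)\<^sup>2)"
  defines "c_i \<equiv> (\<forall>t\<ge>0. \<forall>g\<in>L1 M. ae_eq M (commutator (mult_op A) (U t) g) (\<lambda>x. 0))"
    and "c_ii \<equiv> (\<forall>g. prob_distribution M g \<longrightarrow>
             (\<lambda>t. pairing M A (U t g)) constant_on {0..} \<and>
             (\<lambda>t. pairing M A2 (U t g)) constant_on {0..})"
    and "c_iii \<equiv> (\<forall>g\<in>DomH. mult_op A g \<in> DomH \<and>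
             ae_eq M (mult_op A (H g)) (H (mult_op A g)))"
    and "c_i' \<equiv> (\<forall>t\<ge>0. \<forall>f\<in>Linf M. ae_eq M (commutator (mult_op A) (Us t) f) (\<lambda>x. 0))"
    and "c_ii' \<equiv> (\<forall>t\<ge>0. ae_eq M (Us t A) A \<and> ae_eq M (Us t A2) A2)"
    and "c_iii' \<equiv> (A \<in> DomHs \<and> A2 \<in> DomHs \<and>
             ae_eq M (Hs A) (\<lambda>x. 0) \<and> ae_eq M (Hs A2) (\<lambda>x. 0))"
  shows "(c_i \<longleftrightarrow> c_ii) \<and> (c_i \<longleftrightarrow> c_iii) \<and> (c_i \<longleftrightarrow> c_i') \<and> (c_i \<longleftrightarrow> c_ii') \<and> (c_i \<longleftrightarrow> c_iii')"
proof -
  note M = assms(1) and U = assms(2) and A = assms(3)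
  have A2_eq: "A2 = (\<lambda>x. A x * A x)" unfolding A2_def by (simp add: power2_eq_square)
  have A2: "A2 \<in> Linf M" unfolding A2_eq by (rule Linf_mult[OF A A])
  define cons where "cons \<longleftrightarrow> conserved M U A \<and> conserved M U A2"
  have i: "c_i \<longleftrightarrow> (\<forall>t\<ge>0. \<forall>g\<in>L1 M. AE x in M. A x * U t g x = U t (\<lambda>x. A x * g x) x)"
    by (simp add: c_i_def ae_eq_def commutator_def mult_op_def)
  have i': "c_i' \<longleftrightarrow> (\<forall>t\<ge>0. \<forall>f\<in>Linf M. AE x in M. A x * dual_op M (U t) f x = dual_op M (U t) (\<lambda>x. A x * f x) x)"
    by (simp add: c_i'_def ae_eq_def commutator_def mult_op_def Us_def)
  have dual: "c_i \<longleftrightarrow> c_i'"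
    unfolding i i' using commute_iff_dual_commute[OF M semigroup_stochastic[OF U] A] by blast
  have ii: "c_ii \<longleftrightarrow> cons"
    unfolding c_ii_def cons_def conserved_iff_expectation_constant[OF M U A]
      conserved_iff_expectation_constant[OF M U A2] by blast
  have ii': "c_ii' \<longleftrightarrow> cons"
    unfolding c_ii'_def cons_def conserved_iff_dual_op_fixed[OF M U A]
      conserved_iff_dual_op_fixed[OF M U A2] ae_eq_def Us_def by blast
  have iii': "c_iii' \<longleftrightarrow> cons"
    unfolding c_iii'_def cons_def conserved_iff_wstar_generator_zero[OF M U A]
      conserved_iff_wstar_generator_zero[OF M U A2] ae_eq_def Hs_def DomHs_def by blast
  have "cons" if c_i
  proof -
    have inv_A: "pairing M A (U t g) = pairing M A g" if t: "0 \<le> t" and g: "g \<in> L1 M" for t g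
    proof -
      note T = semigroup_stochastic[OF U t]
      have "pairing M A (U t g) = pairing M (\<lambda>x. 1) (\<lambda>x. A x * U t g x)" by (simp add: pairing_def)
      also have "\<dots> = pairing M (\<lambda>x. 1) (U t (\<lambda>x. A x * g x))"
        using \<open>c_i\<close> t g unfolding i
        by (intro pairing_right_cong Linf_const Linf_times_L1 stochastic_L1[OF T] A) auto
      also have "\<dots> = pairing M (\<lambda>x. 1) (\<lambda>x. A x * g x)"
        by (rule stochastic_integral[OF T Linf_times_L1[OF A g]])
      finally show ?thesis by (simp add: pairing_def)
    qed
    have "pairing M A2 (U t g) = pairing M A2 g" if t: "0 \<le> t" and g: "g \<in> L1 M" for t g
    proof -
      note T = semigroup_stochastic[OF U t]
      have "pairing M A2 (U t g) = pairing M A (\<lambda>x. A x * U t g x)"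
        unfolding A2_eq by (rule pairing_mult)
      also have "\<dots> = pairing M A (U t (\<lambda>x. A x * g x))"
        using \<open>c_i\<close> t g unfolding i
        by (intro pairing_right_cong Linf_times_L1 stochastic_L1[OF T] A) auto
      also have "\<dots> = pairing M A (\<lambda>x. A x * g x)"
        by (rule inv_A[OF t Linf_times_L1[OF A g]])
      finally show ?thesis unfolding A2_eq by (simp add: pairing_mult)
    qed
    with inv_A show cons by (simp add: cons_def conserved_def)
  qed
  moreover have c_i' if cons
  proof -
    have fixed: "AE x in M. dual_op M (U t) A x = A x"
        "AE x in M. dual_op M (U t) (\<lambda>x. A x * A x) x = A x * A x" if "0 \<le> t" for t
      using \<open>cons\<close> that conserved_iff_dual_op_fixed[OF M U A] conserved_iff_dual_op_fixed[OF M U A2]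
      unfolding cons_def A2_eq by auto
    show ?thesis
      unfolding i'
    proof (intro allI impI ballI)
      fix t :: real and f assume t: "0 \<le> t" and f: "f \<in> Linf M"
      show "AE x in M. A x * dual_op M (U t) f x = dual_op M (U t) (\<lambda>x. A x * f x) x"
        using dual_op_multiplicative[OF M semigroup_stochastic[OF U t] A f fixed[OF t]]
        by eventually_elim simp
    qed
  qed
  moreover have c_iii if c_i
    unfolding c_iii_def DomH_def H_def ae_eq_def mult_op_def
  proof (rule ballI)
    fix g assume g: "g \<in> generator_dom M U"
    then have gL: "g \<in> L1 M" by (simp add: generator_dom_def)
    have v: "is_generator_value M U (\<lambda>x. A x * g x) (\<lambda>x. A x * generator M U g x)"
      using \<open>c_i\<close> gL unfolding i by (intro generator_value_mult[OF U A gL _ generator_value[OF g]]) auto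
    then have dom: "(\<lambda>x. A x * g x) \<in> generator_dom M U"
      using Linf_times_L1[OF A gL] by (auto simp: generator_dom_def)
    show "(\<lambda>x. A x * g x) \<in> generator_dom M U \<and>
        (AE x in M. A x * generator M U g x = generator M U (\<lambda>x. A x * g x) x)"
      using dom generator_value_unique[OF U Linf_times_L1[OF A gL] v generator_value[OF dom]] by blast
  qed
  moreover have cons if c_iii
  proof -
    have dom: "(\<lambda>x. A x * g x) \<in> generator_dom M U"
      and comm: "AE x in M. A x * generator M U g x = generator M U (\<lambda>x. A x * g x) x"
      if "g \<in> generator_dom M U" for g
      using \<open>c_iii\<close> that unfolding c_iii_def DomH_def H_def ae_eq_def mult_op_def by auto
    have HL: "generator M U g \<in> L1 M" if "g \<in> generator_dom M U" for g
      using generator_value[OF that] by (simp add: is_generator_value_def)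
    have zero_A: "pairing M A (generator M U g) = 0" if g: "g \<in> generator_dom M U" for g
    proof -
      have "pairing M A (generator M U g) = pairing M (\<lambda>x. 1) (\<lambda>x. A x * generator M U g x)"
        by (simp add: pairing_def)
      also have "\<dots> = pairing M (\<lambda>x. 1) (generator M U (\<lambda>x. A x * g x))"
        by (intro pairing_right_cong Linf_const Linf_times_L1 A HL g dom comm)
      also have "\<dots> = 0"
        using generator_integral[OF U _ generator_value[OF dom[OF g]]] dom[OF g]
        by (simp add: generator_dom_def)
      finally show ?thesis .
    qed
    have zero_A2: "pairing M A2 (generator M U g) = 0" if g: "g \<in> generator_dom M U" for g
    proof -
      have "pairing M A2 (generator M U g) = pairing M A (\<lambda>x. A x * generator M U g x)"
        unfolding A2_eq by (rule pairing_mult)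
      also have "\<dots> = pairing M A (generator M U (\<lambda>x. A x * g x))"
        by (intro pairing_right_cong Linf_times_L1 A HL g dom comm)
      also have "\<dots> = 0" by (rule zero_A[OF dom[OF g]])
      finally show ?thesis .
    qed
    show cons
      unfolding cons_def
      using conserved_if_generator_integral_zero[OF M U A zero_A]
        conserved_if_generator_integral_zero[OF M U A2 zero_A2] by blast
  qed
  ultimately show ?thesis using dual ii ii' iii' by blast
qed

end
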